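(* Let $\mathbf{G}$ be a finite group that is not nilpotent. Then no reduct of $\mathbf{G}$ is a supernilpotent loop, and no reduct of $\mathbf{G}$ is a nilpotent group. That is, there is no binary term operation $*$ of $\mathbf{G}$ such that $(G,* )$ is a supernilpotent loop, and none such that $(G,* )$ is a nilpotent group.
   Context: An algebra $\mathbf{A}=(A,F)$ is a set $A$ with a list $F$ of basic operations. A term operation of $\mathbf{A}$ is a finitary operation on $A$ obtained by composing basic operations and projections; a polynomial operation is obtained by composing basic operations, projections and constants. An algebra $(A,G)$ is a reduct of $\mathbf{A}$ if every operation in $G$ is a term operation of $\mathbf{A}$. Groups are viewed as algebras $(G,\cdot,{}^{-1},1)$. A loop is an algebra $(A,\cdot,\backslash,/,1)$ satisfying $x\backslash(xy)=y$, $x(x\backslash y)=y$, $(yx)/x=y$, $(y/x)x=y$, $x\cdot 1=1\cdot x=x$; equivalently a groupoid $(A,\cdot)$ with identity $1$ such that for all $a,b\in A$ the equations $ax=b$ and $ya=b$ have unique solutions. A finite loop $(A,\cdot,\backslash,/,1)$ has the same term operations as $(A,\cdot)$, so the two presentations are not distinguished. Supernilpotence: for congruences $\alpha_1,\dots,\alpha_n$ ($n\ge 2$) of an algebra $\mathbf{A}$, the ($n$-ary, term condition) commutator $[\alpha_1,\dots,\alpha_n]$ is the smallest congruence $\delta$ such that for all polynomial operations $f$ of $\mathbf{A}$ (with variables split into $n$ blocks) and all tuples $a_i,b_i$ of the corresponding block lengths that are coordinatewise congruent modulo $\alpha_i$: if $f(x_1,\dots,x_{n-1},a_n)\equiv_\delta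 f(x_1,\dots,x_{n-1},b_n)$ for all $(x_1,\dots,x_{n-1})\in\prod_{i<n}\{a_i,b_i\}$ different from $(b_1,\dots,b_{n-1})$, then $f(b_1,\dots,b_{n-1},a_n)\equiv_\delta f(b_1,\dots,b_{n-1},b_n)$. With $0_A$ equality and $1_A$ the total congruence, $\mathbf{A}$ is supernilpotent if for some $k\ge 1$ the $(k+1)$-ary commutator $[1_A,\dots,1_A]$ equals $0_A$. (It is known that a finite loop is supernilpotent iff it is a direct product of (centrally) nilpotent loops of prime power order.) *)

theory Defs
  imports "HOL-Algebra.Generated_Groups"
begin

text \<open>
  An operation is a pair of an arity \<open>n\<close> and a function on lists; only its values on lists
  of length \<open>n\<close> over the universe matter. The order of the basic operations plays no role for
  the notions below, so they are collected in a set.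
\<close>

type_synonym 'a operation = "nat \<times> ('a list \<Rightarrow> 'a)"

record 'a alg =
  universe :: "'a set"
  basic_ops :: "'a operation set"

definition tuples :: "'a set \<Rightarrow> nat \<Rightarrow> 'a list set" where
  "tuples A n = {xs. length xs = n \<and> set xs \<subseteq> A}"

definition closed_alg :: "'a alg \<Rightarrow> bool" where
  "closed_alg A \<longleftrightarrow>
    (\<forall>(n, f) \<in> basic_ops A. \<forall>xs \<in> tuples (universe A) n. f xs \<in> universe A)"

inductive composed :: "'a operation set \<Rightarrow> nat \<Rightarrow> ('a list \<Rightarrow> 'a) \<Rightarrow> bool"
  for F :: "'a operation set" and n :: nat where
  projection: "i < n \<Longrightarrow> composed F n (\<lambda>xs. xs ! i)"
| composition: "\<lbrakk>(k, f) \<in> F; length gs = k; \<forall>g \<in> set gs. composed F n g\<rbrakk>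
    \<Longrightarrow> composed F n (\<lambda>xs. f (map (\<lambda>g. g xs) gs))"

definition is_term_operation :: "'a alg \<Rightarrow> nat \<Rightarrow> ('a list \<Rightarrow> 'a) \<Rightarrow> bool" where
  "is_term_operation A n f \<longleftrightarrow>
    (\<exists>t. composed (basic_ops A) n t \<and> (\<forall>xs \<in> tuples (universe A) n. f xs = t xs))"

definition is_polynomial_operation :: "'a alg \<Rightarrow> nat \<Rightarrow> ('a list \<Rightarrow> 'a) \<Rightarrow> bool" where
  "is_polynomial_operation A n f \<longleftrightarrow>
    (\<exists>t. composed (basic_ops A \<union> {(0, \<lambda>_. c) | c. c \<in> universe A}) n t \<and>
         (\<forall>xs \<in> tuples (universe A) n. f xs = t xs))"

definition is_reduct :: "'a alg \<Rightarrow> 'a alg \<Rightarrow> bool" where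
  "is_reduct B A \<longleftrightarrow> universe B = universe A \<and>
    (\<forall>(n, f) \<in> basic_ops B. is_term_operation A n f)"

definition congruence :: "'a alg \<Rightarrow> ('a \<times> 'a) set \<Rightarrow> bool" where
  "congruence A \<delta> \<longleftrightarrow> equiv (universe A) \<delta> \<and>
    (\<forall>(n, f) \<in> basic_ops A. \<forall>xs \<in> tuples (universe A) n. \<forall>ys \<in> tuples (universe A) n.
       list_all2 (\<lambda>x y. (x, y) \<in> \<delta>) xs ys \<longrightarrow> (f xs, f ys) \<in> \<delta>)"

text \<open>
  The term condition for congruences \<open>\<alpha>\<^sub>1, \<dots>, \<alpha>\<^sub>n\<close>, listed as \<open>\<alpha>s\<close> (0-indexed).
  The \<open>i\<close>-th blocks are \<open>as ! i\<close> and \<open>bs ! i\<close>. A choice of \<open>x\<^sub>i \<in> {a\<^sub>i, b\<^sub>i}\<close>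
  for \<open>i < n\<close> is given by the set \<open>S\<close> of indices at which \<open>b\<^sub>i\<close> is chosen; the excluded
  choice is the one taking \<open>b\<^sub>i\<close> everywhere. Choices are deliberately distinguished by \<open>S\<close>
  and not by the resulting tuple: if \<open>a\<^sub>i = b\<^sub>i\<close> for some \<open>i < n\<close>, comparing tuples would
  discard the hypotheses for all choices that happen to equal \<open>(b\<^sub>1, \<dots>, b\<^sub>n\<^sub>-\<^sub>1)\<close> and so
  force \<open>\<alpha>\<^sub>n \<subseteq> \<delta>\<close>, whereas here these instances are trivially true.
\<close>

definition choose_blocks ::
    "'a list list \<Rightarrow> 'a list list \<Rightarrow> nat \<Rightarrow> nat set \<Rightarrow> 'a list" where
  "choose_blocks as bs m S = concat (map (\<lambda>i. if i \<in> S then bs ! i else as ! i) [0..<m])"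

definition term_condition ::
    "'a alg \<Rightarrow> ('a \<times> 'a) set list \<Rightarrow> ('a \<times> 'a) set \<Rightarrow> bool" where
  "term_condition A \<alpha>s \<delta> \<longleftrightarrow>
    (let m = length \<alpha>s - 1 in
     \<forall>f as bs.
       length as = length \<alpha>s \<longrightarrow> length bs = length \<alpha>s \<longrightarrow>
       (\<forall>i < length \<alpha>s. list_all2 (\<lambda>x y. (x, y) \<in> \<alpha>s ! i) (as ! i) (bs ! i)) \<longrightarrow>
       is_polynomial_operation A (length (concat as)) f \<longrightarrow>
       (\<forall>S. S \<subset> {0..<m} \<longrightarrow>
          (f (choose_blocks as bs m S @ as ! m), f (choose_blocks as bs m S @ bs ! m)) \<in> \<delta>) \<longrightarrow>
       (f (choose_blocks as bs m {0..<m} @ as ! m),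
        f (choose_blocks as bs m {0..<m} @ bs ! m)) \<in> \<delta>)"

definition commutator :: "'a alg \<Rightarrow> ('a \<times> 'a) set list \<Rightarrow> ('a \<times> 'a) set" where
  "commutator A \<alpha>s = \<Inter> {\<delta>. congruence A \<delta> \<and> term_condition A \<alpha>s \<delta>}"

definition zero_congruence :: "'a alg \<Rightarrow> ('a \<times> 'a) set" where
  "zero_congruence A = Id_on (universe A)"

definition one_congruence :: "'a alg \<Rightarrow> ('a \<times> 'a) set" where
  "one_congruence A = universe A \<times> universe A"

definition supernilpotent :: "'a alg \<Rightarrow> bool" where
  "supernilpotent A \<longleftrightarrow>
    (\<exists>k \<ge> 1. commutator A (replicate (k + 1) (one_congruence A)) = zero_congruence A)"

definition group_algebra :: "('a, 'b) monoid_scheme \<Rightarrow> 'a alg" where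
  "group_algebra G = \<lparr>universe = carrier G,
     basic_ops = {(2, \<lambda>xs. xs ! 0 \<otimes>\<^bsub>G\<^esub> xs ! 1), (1, \<lambda>xs. inv\<^bsub>G\<^esub> (xs ! 0)), (0, \<lambda>_. \<one>\<^bsub>G\<^esub>)}\<rparr>"

definition groupoid_algebra :: "'a set \<Rightarrow> ('a \<Rightarrow> 'a \<Rightarrow> 'a) \<Rightarrow> 'a alg" where
  "groupoid_algebra A m = \<lparr>universe = A, basic_ops = {(2, \<lambda>xs. m (xs ! 0) (xs ! 1))}\<rparr>"

text \<open>In \<open>loop_algebra A m ld rd e\<close> and \<open>is_loop A m ld rd e\<close>, \<open>ld x y\<close> is the left division
  of \<open>y\<close> by \<open>x\<close> (the solution \<open>z\<close> of \<open>m x z = y\<close>) and \<open>rd y x\<close> is the right division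
  of \<open>y\<close> by \<open>x\<close>.\<close>

definition loop_algebra ::
    "'a set \<Rightarrow> ('a \<Rightarrow> 'a \<Rightarrow> 'a) \<Rightarrow> ('a \<Rightarrow> 'a \<Rightarrow> 'a) \<Rightarrow> ('a \<Rightarrow> 'a \<Rightarrow> 'a) \<Rightarrow> 'a \<Rightarrow> 'a alg" where
  "loop_algebra A m ld rd e = \<lparr>universe = A,
     basic_ops = {(2, \<lambda>xs. m (xs ! 0) (xs ! 1)), (2, \<lambda>xs. ld (xs ! 0) (xs ! 1)),
                  (2, \<lambda>xs. rd (xs ! 0) (xs ! 1)), (0, \<lambda>_. e)}\<rparr>"

definition is_loop ::
    "'a set \<Rightarrow> ('a \<Rightarrow> 'a \<Rightarrow> 'a) \<Rightarrow> ('a \<Rightarrow> 'a \<Rightarrow> 'a) \<Rightarrow> ('a \<Rightarrow> 'a \<Rightarrow> 'a) \<Rightarrow> 'a \<Rightarrow> bool" where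
  "is_loop A m ld rd e \<longleftrightarrow> e \<in> A \<and>
    (\<forall>x \<in> A. m x e = x \<and> m e x = x) \<and>
    (\<forall>x \<in> A. \<forall>y \<in> A. m x y \<in> A \<and> ld x y \<in> A \<and> rd x y \<in> A \<and>
       ld x (m x y) = y \<and> m x (ld x y) = y \<and>
       rd (m y x) x = y \<and> m (rd y x) x = y)"

definition is_loop_groupoid :: "'a set \<Rightarrow> ('a \<Rightarrow> 'a \<Rightarrow> 'a) \<Rightarrow> bool" where
  "is_loop_groupoid A m \<longleftrightarrow>
    (\<forall>x \<in> A. \<forall>y \<in> A. m x y \<in> A) \<and>
    (\<exists>e \<in> A. \<forall>x \<in> A. m x e = x \<and> m e x = x) \<and>
    (\<forall>a \<in> A. \<forall>b \<in> A. (\<exists>!x. x \<in> A \<and> m a x = b) \<and> (\<exists>!y. y \<in> A \<and> m y a = b))"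

primrec lower_central :: "('a, 'b) monoid_scheme \<Rightarrow> nat \<Rightarrow> 'a set" where
  "lower_central G 0 = carrier G"
| "lower_central G (Suc n) =
     generate G (\<Union>x \<in> lower_central G n. \<Union>y \<in> carrier G.
       {x \<otimes>\<^bsub>G\<^esub> y \<otimes>\<^bsub>G\<^esub> inv\<^bsub>G\<^esub> x \<otimes>\<^bsub>G\<^esub> inv\<^bsub>G\<^esub> y})"

definition nilpotent_group :: "('a, 'b) monoid_scheme \<Rightarrow> bool" where
  "nilpotent_group G \<longleftrightarrow> group G \<and> (\<exists>n. lower_central G n = {\<one>\<^bsub>G\<^esub>})"

lemma composed_in_universe:
  assumes "composed F n t"
    and "\<And>k f ys. (k, f) \<in> F \<Longrightarrow> ys \<in> tuples A k \<Longrightarrow> f ys \<in> A"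
    and "xs \<in> tuples A n"
  shows "t xs \<in> A"
  using assms(1)
proof (induction rule: composed.induct)
  case (projection i)
  then show ?case using assms(3) by (auto simp: tuples_def)
next
  case (composition k f gs)
  then have "map (\<lambda>g. g xs) gs \<in> tuples A k" by (auto simp: tuples_def)
  then show ?case using composition assms(2) by blast
qed

lemma polynomial_in_universe:
  assumes "closed_alg A" "is_polynomial_operation A n f" "xs \<in> tuples (universe A) n"
  shows "f xs \<in> universe A"
proof -
  obtain t where t: "composed (basic_ops A \<union> {(0, \<lambda>_. c) | c. c \<in> universe A}) n t"
    and ft: "f xs = t xs"
    using assms(2,3) by (auto simp: is_polynomial_operation_def)
  have "t xs \<in> universe A"
    by (rule composed_in_universe[OF t _ assms(3)])
      (use assms(1) in \<open>auto simp: closed_alg_def\<close>)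
  then show ?thesis using ft by simp
qed

lemma congruence_one: "closed_alg A \<Longrightarrow> congruence A (one_congruence A)"
  unfolding congruence_def one_congruence_def closed_alg_def
  by (auto intro!: equivI simp: refl_on_def sym_def trans_def)

lemma choose_blocks_in:
  assumes "\<forall>i < m. set (as ! i) \<subseteq> U \<and> set (bs ! i) \<subseteq> U"
  shows "set (choose_blocks as bs m S) \<subseteq> U"
  using assms unfolding choose_blocks_def by (auto split: if_splits)

lemma choose_blocks_length:
  assumes "length as = Suc m" "\<forall>i < Suc m. length (as ! i) = length (bs ! i)"
  shows "length (choose_blocks as bs m S @ as ! m) = length (concat as)"
    and "length (choose_blocks as bs m S @ bs ! m) = length (concat as)"
proof -
  have 1: "sum_list (map (length \<circ> (\<lambda>i. if i \<in> S then bs ! i else as ! i)) [0..<m]) =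
      (\<Sum>i\<leftarrow>[0..<m]. length (as ! i))"
    by (rule arg_cong[where f = sum_list]) (use assms(2) in auto)
have "as = map (\<lambda>i. as ! i) [0..<Suc m]"
    using assms(1) by (metis map_nth)
  then have "map length as = map (\<lambda>i. length (as ! i)) [0..<m] @ [length (as ! m)]"
    by (metis (no_types, lifting) length_map map_append map_eq_conv map_map comp_def
        upt_Suc_append zero_le list.map)
  then show "length (choose_blocks as bs m S @ as ! m) = length (concat as)"
    using 1 by (simp add: choose_blocks_def length_concat)
  then show "length (choose_blocks as bs m S @ bs ! m) = length (concat as)"
    using assms(2) by simp
qed

lemma term_condition_one:
  assumes A: "closed_alg A" and \<alpha>: "\<alpha>s \<noteq> []" "\<forall>\<alpha> \<in> set \<alpha>s. congruence A \<alpha>"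
  shows "term_condition A \<alpha>s (one_congruence A)"
  unfolding term_condition_def Let_def
proof (intro allI impI)
  fix f as bs
  let ?m = "length \<alpha>s - 1"
  assume len: "length as = length \<alpha>s" "length bs = length \<alpha>s"
    and ab: "\<forall>i < length \<alpha>s. list_all2 (\<lambda>x y. (x, y) \<in> \<alpha>s ! i) (as ! i) (bs ! i)"
    and f: "is_polynomial_operation A (length (concat as)) f"
  have m: "length \<alpha>s = Suc ?m" using \<alpha>(1) by (cases \<alpha>s) auto
  have sub: "\<alpha>s ! i \<subseteq> universe A \<times> universe A" if "i < length \<alpha>s" for i
    using \<alpha>(2) that nth_mem unfolding congruence_def equiv_def by blast
  have U: "set (as ! i) \<subseteq> universe A \<and> set (bs ! i) \<subseteq> universe A" if "i < length \<alpha>s" for i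
  proof -
    have l: "list_all2 (\<lambda>x y. (x, y) \<in> \<alpha>s ! i) (as ! i) (bs ! i)" using ab that by blast
    show ?thesis
      using l sub[OF that] by (auto simp: list_all2_conv_all_nth in_set_conv_nth) blast+
  qed
  have L: "\<forall>i < Suc ?m. length (as ! i) = length (bs ! i)"
    using ab m by (auto simp: list_all2_lengthD)
  have C: "set (choose_blocks as bs ?m {0..<?m}) \<subseteq> universe A"
    by (rule choose_blocks_in) (use U in auto)
  have "choose_blocks as bs ?m {0..<?m} @ as ! ?m \<in> tuples (universe A) (length (concat as))"
    "choose_blocks as bs ?m {0..<?m} @ bs ! ?m \<in> tuples (universe A) (length (concat as))"
    using choose_blocks_length[OF _ L, of "{0..<?m}"] len m C U[of ?m] by (auto simp: tuples_def)
  then show "(f (choose_blocks as bs ?m {0..<?m} @ as ! ?m),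
      f (choose_blocks as bs ?m {0..<?m} @ bs ! ?m)) \<in> one_congruence A"
    using polynomial_in_universe[OF A f] by (auto simp: one_congruence_def)
qed

text \<open>The commutator is indeed the smallest congruence satisfying the term condition.\<close>

lemma commutator_least:
  assumes A: "closed_alg A" and \<alpha>: "\<alpha>s \<noteq> []" "\<forall>\<alpha> \<in> set \<alpha>s. congruence A \<alpha>"
  shows "congruence A (commutator A \<alpha>s)"
    and "term_condition A \<alpha>s (commutator A \<alpha>s)"
    and "\<And>\<delta>. congruence A \<delta> \<Longrightarrow> term_condition A \<alpha>s \<delta> \<Longrightarrow> commutator A \<alpha>s \<subseteq> \<delta>"
proof -
  let ?D = "{\<delta>. congruence A \<delta> \<and> term_condition A \<alpha>s \<delta>}"
  have one: "one_congruence A \<in> ?D"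
    using congruence_one[OF A] term_condition_one[OF assms] by simp
  have eq: "equiv (universe A) \<delta>" if "\<delta> \<in> ?D" for \<delta>
    using that by (simp add: congruence_def)
  have "equiv (universe A) (\<Inter> ?D)"
  proof (rule equivI)
    show "\<Inter> ?D \<subseteq> universe A \<times> universe A"
      using one unfolding one_congruence_def by blast
    show "refl_on (universe A) (\<Inter> ?D)"
      using eq unfolding equiv_def refl_on_def by blast
    show "sym (\<Inter> ?D)"
      using eq unfolding equiv_def sym_def by blast
    show "trans (\<Inter> ?D)"
      using eq unfolding equiv_def trans_def by blast
  qed
  moreover have "(f xs, f ys) \<in> \<Inter> ?D"
    if nf: "(n, f) \<in> basic_ops A" and xs: "xs \<in> tuples (universe A) n"
      and ys: "ys \<in> tuples (universe A) n"
      and l: "list_all2 (\<lambda>x y. (x, y) \<in> \<Inter> ?D) xs ys" for n f xs ys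
  proof
    fix \<delta> assume d: "\<delta> \<in> ?D"
    have "list_all2 (\<lambda>x y. (x, y) \<in> \<delta>) xs ys"
      by (rule list_all2_mono[OF l]) (use d in blast)
    then show "(f xs, f ys) \<in> \<delta>"
      using d nf xs ys unfolding congruence_def by blast
  qed
  ultimately show "congruence A (commutator A \<alpha>s)"
    unfolding commutator_def congruence_def[of A "\<Inter> ?D"] by blast
  show "term_condition A \<alpha>s (commutator A \<alpha>s)"
    unfolding commutator_def term_condition_def[of A \<alpha>s "\<Inter> ?D"] Let_def
  proof (intro allI impI InterI, goal_cases)
    case (1 f as bs \<delta>)
    have "term_condition A \<alpha>s \<delta>" using 1(6) by simp
    from this[unfolded term_condition_def Let_def, rule_format, OF 1(1,2) _ 1(4)] 1(3,5,6)
    show ?case by blast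
  qed
  show "\<And>\<delta>. congruence A \<delta> \<Longrightarrow> term_condition A \<alpha>s \<delta> \<Longrightarrow> commutator A \<alpha>s \<subseteq> \<delta>"
    unfolding commutator_def by blast
qed

end

theory Submission
  imports "HOL-Algebra.Sylow" "HOL-Algebra.Group_Action" "HOL-Algebra.Multiplicative_Group" Defs
begin

text \<open>
  Call \<open>x\<close> and \<open>y\<close> coprime if \<open>x\<^sup>a = 1\<close> and \<open>y\<^sup>b = 1\<close> for coprime \<open>a\<close> and \<open>b\<close>. The proof compares
  a group and a loop on the same set through their coprime elements. A finite group in which
  coprime elements commute is nilpotent (\<open>coprime_commuting_imp_nilpotent\<close>), so it is enough to
  derive this commutation in \<open>G\<close> from the reduct \<open>(G, *)\<close>.

  Powers survive the passage to a reduct: on powers of a single element \<open>x\<close>, a group term returns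
  \<open>x\<close> raised to a fixed linear combination of the exponents. If \<open>*\<close> has an identity element and
  admits cancellation, this forces the identity to be \<open>1\<close> and \<open>x\<^sup>i * x\<^sup>j = x\<close> raised to \<open>i + j\<close>
  (\<open>unital_term_preserves_powers\<close>). Suppose moreover that \<open>(x * y)\<^sup>n = x\<^sup>n * y\<^sup>n\<close> for all \<open>n\<close> and
  coprime \<open>x\<close>, \<open>y\<close>. For \<open>n\<close> congruent to \<open>1\<close> modulo \<open>a\<close> and to \<open>0\<close> modulo \<open>b\<close> the right-hand side
  is \<open>x\<close>, and \<open>y\<close> arises in the same way. So \<open>x\<close> and \<open>y\<close> are powers, in \<open>G\<close>, of the one
  element \<open>x * y\<close>, and they commute in \<open>G\<close> (\<open>commute_of_power_homomorphism\<close>).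

  It remains to see that raising to powers respects products of coprime elements in the reduct.
  In a nilpotent group this is clear, since coprime elements commute there
  (\<open>nilpotent_imp_coprime_commuting\<close>). In a supernilpotent loop, consider absorbing terms, those
  that take the value \<open>1\<close> whenever some argument is \<open>1\<close>. The term condition kills all of them at
  some arity \<open>k + 1\<close> (\<open>supernilpotent_absorbing_trivial\<close>). Vanishing on tuples that contain two
  coprime elements then descends to all smaller arities down to \<open>2\<close>: the defect of additivity of
  \<open>f\<close> in its first argument is an absorbing term with one more argument, so \<open>f\<close> is additive on
  the powers of \<open>x\<close>, whence the value \<open>f(x, y, \<dots>)\<close> is annihilated by \<open>a\<close>, by symmetry
  also by \<open>b\<close>, and is therefore \<open>1\<close> (\<open>coprime_vanishing_descends\<close>). The binary case for the
  right quotient of \<open>(x * y)\<^sup>n\<close> by \<open>x\<^sup>n * y\<^sup>n\<close> is the required identity.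
\<close>

(* From here on, mult is the multiplication field of the record type of monoids. *)
hide_const (open) Multiset.mult

section \<open>Commutators and coprime elements in groups\<close>

definition commutator_of :: "('a, 'b) monoid_scheme \<Rightarrow> 'a \<Rightarrow> 'a \<Rightarrow> 'a" where
  "commutator_of G x y = x \<otimes>\<^bsub>G\<^esub> y \<otimes>\<^bsub>G\<^esub> inv\<^bsub>G\<^esub> x \<otimes>\<^bsub>G\<^esub> inv\<^bsub>G\<^esub> y"

definition coprime_commuting :: "('a, 'b) monoid_scheme \<Rightarrow> bool" where
  "coprime_commuting G \<longleftrightarrow>
    (\<forall>x \<in> carrier G. \<forall>y \<in> carrier G. \<forall>a b :: nat. coprime a b \<longrightarrow>
       x [^]\<^bsub>G\<^esub> a = \<one>\<^bsub>G\<^esub> \<longrightarrow> y [^]\<^bsub>G\<^esub> b = \<one>\<^bsub>G\<^esub> \<longrightarrow> x \<otimes>\<^bsub>G\<^esub> y = y \<otimes>\<^bsub>G\<^esub> x)"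

lemma coprime_commutingD:
  assumes "coprime_commuting G" "x \<in> carrier G" "y \<in> carrier G" "coprime a b"
    and "x [^]\<^bsub>G\<^esub> (a :: nat) = \<one>\<^bsub>G\<^esub>" "y [^]\<^bsub>G\<^esub> (b :: nat) = \<one>\<^bsub>G\<^esub>"
  shows "x \<otimes>\<^bsub>G\<^esub> y = y \<otimes>\<^bsub>G\<^esub> x"
  using assms unfolding coprime_commuting_def by blast

context group
begin

lemma cancel_left:
  assumes "x \<in> carrier G" "z \<in> carrier G"
  shows "inv x \<otimes> (x \<otimes> z) = z" and "x \<otimes> (inv x \<otimes> z) = z"
  using assms by (simp_all flip: m_assoc)

lemma commutator_of_closed [simp, intro]:
  "x \<in> carrier G \<Longrightarrow> y \<in> carrier G \<Longrightarrow> commutator_of G x y \<in> carrier G"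
  by (simp add: commutator_of_def)

lemma inv_commutator_of:
  assumes "x \<in> carrier G" "y \<in> carrier G"
  shows "inv (commutator_of G x y) = commutator_of G y x"
  using assms by (simp add: commutator_of_def m_assoc inv_mult_group)

lemma mult_commutator_of:
  assumes "x \<in> carrier G" "y \<in> carrier G"
  shows "commutator_of G x y \<otimes> (y \<otimes> x) = x \<otimes> y"
  using assms by (simp add: commutator_of_def m_assoc cancel_left)

lemma commutator_of_one_iff:
  assumes "x \<in> carrier G" "y \<in> carrier G"
  shows "commutator_of G x y = \<one> \<longleftrightarrow> x \<otimes> y = y \<otimes> x"
  using assms mult_commutator_of[OF assms] r_cancel_one[of "y \<otimes> x" "commutator_of G x y"] by auto

lemma conjugate_commutator_of:
  assumes "x \<in> carrier G" "y \<in> carrier G" "g \<in> carrier G"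
  shows "g \<otimes> commutator_of G x y \<otimes> inv g =
    commutator_of G (g \<otimes> x \<otimes> inv g) (g \<otimes> y \<otimes> inv g)"
  using assms by (simp add: commutator_of_def m_assoc inv_mult_group cancel_left)

text \<open>
  If \<open>c = [x, y]\<close> is central, moving \<open>y\<close> past \<open>x\<^sup>n\<close> costs exactly the factor \<open>c\<^sup>n\<close>. Taking
  \<open>n = a\<close>, and then exchanging the roles of \<open>x\<close> and \<open>y\<close>, shows that \<open>c\<close> is annihilated by \<open>a\<close>
  and by \<open>b\<close>.
\<close>

lemma central_commutator_coprime:
  assumes x: "x \<in> carrier G" "x [^] (a :: nat) = \<one>" and y: "y \<in> carrier G" "y [^] (b :: nat) = \<one>"
    and ab: "coprime a b"
    and central: "\<And>z. z \<in> carrier G \<Longrightarrow> commutator_of G x y \<otimes> z = z \<otimes> commutator_of G x y"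
  shows "commutator_of G x y = \<one>"
proof -
  let ?c = "commutator_of G x y"
  have c: "?c \<in> carrier G" using x y by simp
  have comm: "x \<otimes> y = ?c \<otimes> (y \<otimes> x)" using mult_commutator_of x y by simp
  have xn: "x [^] n \<otimes> y = ?c [^] n \<otimes> (y \<otimes> x [^] n)" for n :: nat
  proof (induction n)
    case (Suc n)
    have "x [^] Suc n \<otimes> y = x [^] n \<otimes> (x \<otimes> y)" using x y by (simp add: m_assoc)
    also have "\<dots> = x [^] n \<otimes> (?c \<otimes> (y \<otimes> x))" by (simp only: comm)
    also have "\<dots> = ?c \<otimes> (x [^] n \<otimes> y) \<otimes> x"
      using x y c central[of "x [^] n"] by (simp flip: m_assoc)
    also have "\<dots> = (?c \<otimes> ?c [^] n) \<otimes> (y \<otimes> x [^] Suc n)"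
      unfolding Suc.IH using x y c by (simp add: m_assoc)
    also have "?c \<otimes> ?c [^] n = ?c [^] Suc n"
      using nat_pow_Suc2[OF c] by simp
    finally show ?case .
  qed (use y in simp)
  have yn: "x \<otimes> y [^] n = ?c [^] n \<otimes> (y [^] n \<otimes> x)" for n :: nat
  proof (induction n)
    case (Suc n)
    have "x \<otimes> y [^] Suc n = (x \<otimes> y [^] n) \<otimes> y" using x y by (simp add: m_assoc)
    also have "\<dots> = ?c [^] n \<otimes> (y [^] n \<otimes> (x \<otimes> y))"
      unfolding Suc.IH using x y c by (simp add: m_assoc)
    also have "\<dots> = ?c [^] n \<otimes> (y [^] n \<otimes> (?c \<otimes> (y \<otimes> x)))" by (simp only: comm)
    also have "\<dots> = ?c [^] n \<otimes> (?c \<otimes> y [^] n \<otimes> (y \<otimes> x))"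
      using x y c central[of "y [^] n"] by (simp flip: m_assoc)
    also have "\<dots> = ?c [^] Suc n \<otimes> (y [^] Suc n \<otimes> x)"
      using x y c by (simp add: m_assoc)
    finally show ?case .
  qed (use x in simp)
  have ca: "?c [^] a = \<one>" using xn[of a] x y c by simp
  have cb: "?c [^] b = \<one>" using yn[of b] x y c by simp
  have "gcd (int a) (int b) = 1" using ab by simp
  then obtain u v where uv: "u * int a + v * int b = 1" using bezout_int by metis
  have "?c = ?c [^] (int a * u + int b * v)" using uv c by (simp add: mult.commute)
  also have "\<dots> = (?c [^] int a) [^] u \<otimes> (?c [^] int b) [^] v"
    using c by (simp add: int_pow_mult int_pow_pow)
  also have "\<dots> = \<one>" using ca cb by (simp add: int_pow_int)
  finally show ?thesis .
qed

lemma lower_central_Suc: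
  "lower_central G (Suc n) = generate G {commutator_of G x y | x y. x \<in> lower_central G n \<and> y \<in> carrier G}"
  by (auto simp: commutator_of_def intro!: arg_cong[where f = "generate G"])

lemma lower_central_normal: "lower_central G n \<lhd> G"
proof (induction n)
  case 0
  show ?case by (simp add: normal_inv_iff subgroup_self)
next
  case (Suc n)
  have sub: "lower_central G n \<subseteq> carrier G"
    using Suc normal_invE(1) subgroup.subset by blast
  show ?case
    unfolding lower_central_Suc
  proof (rule normal_generateI)
    show "{commutator_of G x y |x y. x \<in> lower_central G n \<and> y \<in> carrier G} \<subseteq> carrier G"
      using sub by auto
    fix h g assume "h \<in> {commutator_of G x y |x y. x \<in> lower_central G n \<and> y \<in> carrier G}"
      and g: "g \<in> carrier G"
    then obtain x y where h: "h = commutator_of G x y" "x \<in> lower_central G n" "y \<in> carrier G"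
      by blast
    then show "g \<otimes> h \<otimes> inv g \<in> {commutator_of G x y |x y. x \<in> lower_central G n \<and> y \<in> carrier G}"
      using conjugate_commutator_of[of x y g] sub g normal_invE(2)[OF Suc g h(2)] by blast
  qed
qed

lemma commutator_of_in_lower_central:
  assumes "x \<in> lower_central G n" "y \<in> carrier G"
  shows "commutator_of G x y \<in> lower_central G (Suc n)"
  unfolding lower_central_Suc using assms by (blast intro: generate.incl)

lemma coset_eq_self_iff:
  assumes "subgroup N G" "x \<in> carrier G"
  shows "N #> x = N \<longleftrightarrow> x \<in> N"
  using assms coset_join1 coset_join2 by blast

lemma coset_commutator_of:
  assumes N: "N \<lhd> G" and x: "x \<in> carrier G" "y \<in> carrier G"
  shows "commutator_of (G Mod N) (N #> x) (N #> y) = N #> commutator_of G x y"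
proof -
  interpret group_hom G "G Mod N" "\<lambda>x. N #> x"
    using N normal.r_coset_hom_Mod normal.factorgroup_is_group is_group
    by (auto intro!: group_hom.intro group_hom_axioms.intro)
  show ?thesis using x by (simp add: commutator_of_def)
qed

text \<open>
  The commutator of coprime elements lies in every term of the lower central series: if it lies in
  the \<open>n\<close>-th term, then it is central modulo the next one, and there
  \<open>central_commutator_coprime\<close> makes it trivial.
\<close>

lemma nilpotent_imp_coprime_commuting:
  assumes "nilpotent_group G"
  shows "coprime_commuting G"
  unfolding coprime_commuting_def
proof (intro ballI allI impI)
  fix x y and a b :: nat
  assume x: "x \<in> carrier G" "x [^] a = \<one>" and y: "y \<in> carrier G" "y [^] b = \<one>" and ab: "coprime a b"
  have "commutator_of G x y \<in> lower_central G n" for n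
  proof (induction n)
    case (Suc n)
    let ?N = "lower_central G (Suc n)"
    have N: "?N \<lhd> G" by (rule lower_central_normal)
    interpret Q: group "G Mod ?N" using N by (rule normal.factorgroup_is_group)
    interpret h: group_hom G "G Mod ?N" "\<lambda>x. ?N #> x"
      using N normal.r_coset_hom_Mod is_group Q.is_group
      by (auto intro!: group_hom.intro group_hom_axioms.intro)
    have "commutator_of (G Mod ?N) (?N #> x) (?N #> y) = \<one>\<^bsub>G Mod ?N\<^esub>"
    proof (rule Q.central_commutator_coprime)
      show "(?N #> x) [^]\<^bsub>G Mod ?N\<^esub> a = \<one>\<^bsub>G Mod ?N\<^esub>" "(?N #> y) [^]\<^bsub>G Mod ?N\<^esub> b = \<one>\<^bsub>G Mod ?N\<^esub>"
        using x y by (metis h.hom_nat_pow h.hom_one)+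
      fix z assume "z \<in> carrier (G Mod ?N)"
      then obtain g where g: "g \<in> carrier G" "z = ?N #> g" by (auto simp: carrier_FactGroup)
      have "commutator_of G (commutator_of G x y) g \<in> ?N"
        using commutator_of_in_lower_central Suc g by blast
      then have "commutator_of (G Mod ?N) (?N #> commutator_of G x y) z = \<one>\<^bsub>G Mod ?N\<^esub>"
        using N g x y coset_eq_self_iff[OF normal_invE(1)[OF N]]
        by (simp add: coset_commutator_of del: lower_central.simps)
      then show "commutator_of (G Mod ?N) (?N #> x) (?N #> y) \<otimes>\<^bsub>G Mod ?N\<^esub> z =
          z \<otimes>\<^bsub>G Mod ?N\<^esub> commutator_of (G Mod ?N) (?N #> x) (?N #> y)"
        using N g x y Q.commutator_of_one_iff[of "?N #> commutator_of G x y" z]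
        by (simp add: coset_commutator_of del: lower_central.simps)
    qed (use x y ab in \<open>auto simp del: lower_central.simps\<close>)
    then show ?case
      using N x y coset_eq_self_iff[OF normal_invE(1)[OF N]]
      by (simp add: coset_commutator_of del: lower_central.simps)
  qed (use x y in simp)
  moreover obtain n where "lower_central G n = {\<one>}"
    using assms by (auto simp: nilpotent_group_def)
  ultimately have "commutator_of G x y = \<one>" by blast
  then show "x \<otimes> y = y \<otimes> x" using x y by (simp add: commutator_of_one_iff)
qed

section \<open>Finite groups whose coprime elements commute\<close>

text \<open>
  The class equation: the sizes of conjugacy classes divide a power of \<open>p\<close>, so a trivial center
  would leave the class of \<open>1\<close> as the only class of size not divisible by \<open>p\<close>.
\<close>

lemma p_group_center_nontrivial:
  assumes p: "prime p" and ord: "order G = p ^ n" "0 < n"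
  shows "\<exists>z \<in> carrier G. z \<noteq> \<one> \<and> (\<forall>y \<in> carrier G. z \<otimes> y = y \<otimes> z)"
proof (rule ccontr)
  assume contra: "\<not> ?thesis"
  let ?\<phi> = "\<lambda>g. \<lambda>h \<in> carrier G. g \<otimes> h \<otimes> inv g"
  interpret conj: group_action G "carrier G" ?\<phi> by (rule action_by_conjugation)
  have p0: "p \<noteq> 0" "p \<noteq> 1" using p by auto
  have fin: "finite (carrier G)"
    using ord p0 unfolding order_def by (metis card.infinite power_eq_0_iff)
  let ?O = "orbits G (carrier G) ?\<phi>"
  have orb1: "orbit G ?\<phi> \<one> = {\<one>}"
    by (auto simp: orbit_def intro: exI[of _ \<one>])
  then have in1: "{\<one>} \<in> ?O" unfolding orbits_def by blast
  have fO: "finite ?O" using fin by (simp add: orbits_def)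
  have "p dvd card C" if C: "C \<in> ?O - {{\<one>}}" for C
  proof -
    obtain x where x: "x \<in> carrier G" "C = orbit G ?\<phi> x" using C by (auto simp: orbits_def)
    have "card C dvd p ^ n"
      unfolding x(2) ord(1)[symmetric] conj.orbit_stabilizer_theorem[OF x(1), symmetric]
      by (rule dvd_triv_left)
    then obtain i where i: "card C = p ^ i" using p by (auto simp: divides_primepow_nat)
    moreover have "i \<noteq> 0"
    proof
      assume "i = 0"
      then have "card C = 1" using i by simp
      moreover have "x \<in> C"
        using x by (auto simp: orbit_def intro!: exI[of _ \<one>])
      ultimately have Cx: "C = {x}" by (metis card_1_singletonE singletonD)
      have "x \<otimes> y = y \<otimes> x" if "y \<in> carrier G" for y
      proof -
        have "y \<otimes> x \<otimes> inv y \<in> C" unfolding x(2) orbit_def using that x by force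
        then have "y \<otimes> x \<otimes> inv y = x" using Cx by simp
        then show ?thesis using that x by (metis inv_closed inv_solve_right' m_closed)
      qed
      then have "x = \<one>" using contra x by blast
      then show False using C x orb1 by simp
    qed
    ultimately show ?thesis by (simp add: dvd_power)
  qed
  then have rest: "p dvd (\<Sum>C \<in> ?O - {{\<one>}}. card C)" by (rule dvd_sum)
  have "p ^ n = 1 + (\<Sum>C \<in> ?O - {{\<one>}}. card C)"
  proof -
    have "(\<Sum>C\<in>?O. \<Sum>x\<in>C. 1) = (\<Sum>x\<in>carrier G. (1::nat))"
      by (rule conj.disjoint_sum[OF fin])
    then have "order G = (\<Sum>C\<in>?O. card C)" by (simp add: order_def)
    then show ?thesis using ord sum.remove[OF fO in1, of card] by simp
  qed
  moreover have "p dvd p ^ n" using ord by (simp add: dvd_power)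
  ultimately have "p dvd 1 + (\<Sum>C \<in> ?O - {{\<one>}}. card C)" by simp
  then have "p dvd 1" unfolding dvd_add_left_iff[OF rest] .
  then show False using p0 by simp
qed

text \<open>
  For normal \<open>N\<close> this is the preimage in \<open>G\<close> of the center of \<open>G / N\<close>; iterated from the trivial
  subgroup it gives the upper central series.
\<close>

definition center_mod :: "'a set \<Rightarrow> 'a set" where
  "center_mod N = {x \<in> carrier G. \<forall>y \<in> carrier G. commutator_of G y x \<in> N}"

lemma subgroup_centralizer_mod:
  assumes N: "N \<lhd> G" and x: "x \<in> carrier G"
  shows "subgroup {y \<in> carrier G. commutator_of G x y \<in> N} G"
proof -
  note N' = normal_invE[OF N]
  show ?thesis
  proof (rule subgroupI)
    have "commutator_of G x \<one> = \<one>" using x by (simp add: commutator_of_def)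
    then show "{y \<in> carrier G. commutator_of G x y \<in> N} \<noteq> {}"
      using subgroup.one_closed[OF N'(1)] by auto
  next
    fix y assume "y \<in> {y \<in> carrier G. commutator_of G x y \<in> N}"
    then have y: "y \<in> carrier G" "commutator_of G x y \<in> N" by auto
    have "commutator_of G x (inv y) = inv y \<otimes> inv (commutator_of G x y) \<otimes> inv (inv y)"
      using x y by (simp add: commutator_of_def m_assoc inv_mult_group cancel_left)
    then show "inv y \<in> {y \<in> carrier G. commutator_of G x y \<in> N}"
      using y N'(2)[of "inv y"] subgroup.m_inv_closed[OF N'(1)] by simp
  next
    fix y z assume "y \<in> {y \<in> carrier G. commutator_of G x y \<in> N}"
      and "z \<in> {y \<in> carrier G. commutator_of G x y \<in> N}"
    then have yz: "y \<in> carrier G" "commutator_of G x y \<in> N" "z \<in> carrier G" "commutator_of G x z \<in> N"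
      by auto
    have "commutator_of G x (y \<otimes> z) = commutator_of G x y \<otimes> (y \<otimes> commutator_of G x z \<otimes> inv y)"
      using x yz by (simp add: commutator_of_def m_assoc inv_mult_group cancel_left)
    then show "y \<otimes> z \<in> {y \<in> carrier G. commutator_of G x y \<in> N}"
      using yz N'(2) subgroup.m_closed[OF N'(1)] by simp
  qed auto
qed

lemma subset_center_mod:
  assumes "N \<lhd> G"
  shows "N \<subseteq> center_mod N"
proof
  note N = normal_invE[OF assms]
  fix x assume x: "x \<in> N"
  then have xG: "x \<in> carrier G" using subgroup.subset[OF N(1)] by blast
  have "commutator_of G y x \<in> N" if "y \<in> carrier G" for y
    unfolding commutator_of_def
    using N(2)[OF that x] x subgroup.m_closed[OF N(1)] subgroup.m_inv_closed[OF N(1)] by blast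
  then show "x \<in> center_mod N" using xG by (simp add: center_mod_def)
qed

lemma center_mod_normal:
  assumes N: "N \<lhd> G"
  shows "center_mod N \<lhd> G"
proof (rule normal_invI)
  have "center_mod N = (\<Inter>y \<in> carrier G. {x \<in> carrier G. commutator_of G y x \<in> N})"
    by (auto simp: center_mod_def)
  then show sub: "subgroup (center_mod N) G"
    using subgroup_centralizer_mod[OF N] by (auto intro!: subgroups_Inter)
  fix g x assume g: "g \<in> carrier G" and x: "x \<in> center_mod N"
  have xG: "x \<in> carrier G" using x by (simp add: center_mod_def)
  (* The conjugate of x by g is [g, x] x, and [g, x] already lies in N. *)
  have "commutator_of G g x \<in> center_mod N"
    using x g subset_center_mod[OF N] by (auto simp: center_mod_def)
  then have "commutator_of G g x \<otimes> x \<in> center_mod N"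
    using x subgroup.m_closed[OF sub] by blast
  then show "g \<otimes> x \<otimes> inv g \<in> center_mod N"
    using g xG by (simp add: commutator_of_def m_assoc)
qed

lemma p_group_center_mod:
  assumes p: "prime p" and ord: "order G = p ^ n" and N: "N \<lhd> G" "N \<noteq> carrier G"
  shows "\<exists>x \<in> center_mod N. x \<notin> N"
proof -
  interpret Q: group "G Mod N" using N(1) by (rule normal.factorgroup_is_group)
  have sub: "subgroup N G" using normal_invE(1)[OF N(1)] .
  have lag: "order (G Mod N) * card N = p ^ n"
    using lagrange[OF sub] ord by (simp add: order_def FactGroup_def)
  then obtain i where i: "order (G Mod N) = p ^ i"
    using p by (metis divides_primepow_nat dvd_triv_left)
  have fin: "finite (carrier G)"
    using ord p unfolding order_def by (metis card.infinite power_eq_0_iff not_prime_0)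
  have "i \<noteq> 0"
  proof
    assume "i = 0"
    then have "card N = card (carrier G)" using lag i ord by (simp add: order_def)
    then show False using N(2) fin subgroup.subset[OF sub] card_subset_eq by blast
  qed
  then obtain z where z: "z \<in> carrier (G Mod N)" "z \<noteq> N"
    "\<forall>y \<in> carrier (G Mod N). z \<otimes>\<^bsub>G Mod N\<^esub> y = y \<otimes>\<^bsub>G Mod N\<^esub> z"
    using Q.p_group_center_nontrivial[OF p i] by auto
  then obtain x where x: "x \<in> carrier G" "z = N #> x" by (auto simp: carrier_FactGroup)
  have "commutator_of G y x \<in> N" if y: "y \<in> carrier G" for y
  proof -
    have yM: "N #> y \<in> carrier (G Mod N)" using y by (auto simp: carrier_FactGroup)
    then have "commutator_of (G Mod N) (N #> y) z = \<one>\<^bsub>G Mod N\<^esub>"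
      using z Q.commutator_of_one_iff by metis
    then show ?thesis
      using x y coset_commutator_of[OF N(1)] coset_eq_self_iff[OF sub] by simp
  qed
  then have "x \<in> center_mod N" using x by (simp add: center_mod_def)
  moreover have "x \<notin> N" using z x coset_eq_self_iff[OF sub] by blast
  ultimately show ?thesis by blast
qed

lemma sylow_exists:
  assumes "finite (carrier G)" "prime p"
  shows "\<exists>P. subgroup P G \<and> card P = p ^ multiplicity p (order G)"
proof -
  obtain r where "order G = p ^ multiplicity p (order G) * r"
    using multiplicity_dvd dvdE by blast
  then show ?thesis using sylow_thm assms is_group by blast
qed

lemma subgroup_pow_card:
  assumes "subgroup H G" "x \<in> H"
  shows "x [^] card H = \<one>"
proof -
  interpret H: group "G\<lparr>carrier := H\<rparr>" using assms(1) by (rule subgroup_imp_group)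
  have "x [^]\<^bsub>G\<lparr>carrier := H\<rparr>\<^esub> order (G\<lparr>carrier := H\<rparr>) = \<one>"
    using H.pow_order_eq_1[of x] assms by simp
  then show ?thesis by (simp add: order_def nat_pow_consistent[symmetric])
qed

lemma subgroup_card_dvd:
  assumes "subgroup H G" "subgroup K G" "H \<subseteq> K"
  shows "card H dvd card K"
proof -
  interpret K: group "G\<lparr>carrier := K\<rparr>" using assms(2) by (rule subgroup_imp_group)
  have "card (rcosets\<^bsub>G\<lparr>carrier := K\<rparr>\<^esub> H) * card H = card K"
    using K.lagrange[OF subgroup_incl[OF assms]] by (simp add: order_def)
  then show ?thesis using dvd_triv_right by metis
qed

text \<open>
  Let \<open>p\<close> divide the index of \<open>N\<close> and let \<open>P\<close> be a Sylow \<open>p\<close>-subgroup. It is not contained in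
  \<open>N\<close>, so the \<open>p\<close>-group \<open>P / (N \<inter> P)\<close> has a nontrivial central element, represented by some
  \<open>x \<in> P\<close>. The elements that commute with \<open>x\<close> modulo \<open>N\<close> form a subgroup which contains \<open>P\<close>, and
  which contains every Sylow subgroup for another prime because its elements are coprime to \<open>x\<close>.
  By counting, this subgroup is all of \<open>G\<close>.
\<close>

lemma center_mod_grows:
  assumes fin: "finite (carrier G)" and cc: "coprime_commuting G"
    and N: "N \<lhd> G" "N \<noteq> carrier G"
  shows "\<exists>x \<in> center_mod N. x \<notin> N"
proof -
  have sub: "subgroup N G" using normal_invE(1)[OF N(1)] .
  then have finN: "finite N" using fin subgroup.subset finite_subset by metis
  have lag: "card (rcosets N) * card N = order G" using lagrange[OF sub] .
  have ord0: "order G \<noteq> 0" using fin order_gt_0_iff_finite by simp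
  have "card (rcosets N) \<noteq> 1"
  proof
    assume "card (rcosets N) = 1"
    then have "card N = card (carrier G)" using lag by (simp add: order_def)
    then show False using N(2) fin subgroup.subset[OF sub] card_subset_eq by blast
  qed
  then obtain p where p: "prime p" "p dvd card (rcosets N)" using prime_factor_nat by blast
  let ?e = "multiplicity p (order G)"
  obtain P where P: "subgroup P G" "card P = p ^ ?e" using sylow_exists[OF fin p(1)] by blast
  interpret P: group "G\<lparr>carrier := P\<rparr>" using P(1) by (rule subgroup_imp_group)
  have PG: "P \<subseteq> carrier G" using P(1) by (rule subgroup.subset)
  have comm_P: "commutator_of (G\<lparr>carrier := P\<rparr>) x y = commutator_of G x y" if "x \<in> P" "y \<in> P" for x y
    using that P(1) by (simp add: commutator_of_def m_inv_consistent)
  have "\<not> P \<subseteq> N"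
  proof
    assume "P \<subseteq> N"
    then have "p ^ ?e dvd card N"
      using subgroup_card_dvd[OF P(1) sub] P(2) by simp
    then have "p ^ Suc ?e dvd order G"
      unfolding lag[symmetric] power_Suc by (intro mult_dvd_mono p(2))
    then show False
      using prime_gt_1_nat[OF p(1)] ord0 power_dvd_iff_le_multiplicity[of "order G" p "Suc ?e"] by auto
  qed
  then have proper: "N \<inter> P \<noteq> carrier (G\<lparr>carrier := P\<rparr>)" by auto
  have "N \<inter> P \<lhd> G\<lparr>carrier := P\<rparr>"
  proof (rule P.normal_invI)
    show "subgroup (N \<inter> P) (G\<lparr>carrier := P\<rparr>)"
      using subgroup_incl[OF subgroups_Inter_pair[OF sub P(1)] P(1)] by blast
    fix x h assume "x \<in> carrier (G\<lparr>carrier := P\<rparr>)" "h \<in> N \<inter> P"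
    then show "x \<otimes>\<^bsub>G\<lparr>carrier := P\<rparr>\<^esub> h \<otimes>\<^bsub>G\<lparr>carrier := P\<rparr>\<^esub> inv\<^bsub>G\<lparr>carrier := P\<rparr>\<^esub> x \<in> N \<inter> P"
      using normal_invE(2)[OF N(1)] PG subgroup.m_closed[OF P(1)] subgroup.m_inv_closed[OF P(1)]
      by (auto simp: m_inv_consistent[OF P(1)])
  qed
  from P.p_group_center_mod[OF p(1) _ this proper, of ?e] obtain x
    where x: "x \<in> P" "x \<notin> N" and xP: "\<forall>y \<in> P. commutator_of G y x \<in> N"
    using P(2) comm_P by (auto simp: order_def P.center_mod_def)
  have xG: "x \<in> carrier G" using x PG by blast
  define C where "C = {y \<in> carrier G. commutator_of G x y \<in> N}"
  have C: "subgroup C G" unfolding C_def by (rule subgroup_centralizer_mod[OF N(1) xG])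
  have Sylow_C: "\<exists>Q. subgroup Q G \<and> card Q = q ^ multiplicity q (order G) \<and> Q \<subseteq> C"
    if q: "prime q" for q
  proof (cases "q = p")
    case True
    have "commutator_of G x y \<in> N" if "y \<in> P" for y
      using that xP PG xG inv_commutator_of[of y x] subgroup.m_inv_closed[OF sub] by force
    then show ?thesis using True P PG by (auto simp: C_def)
  next
    case False
    obtain Q where Q: "subgroup Q G" "card Q = q ^ multiplicity q (order G)"
      using sylow_exists[OF fin q] by blast
    have "y \<in> C" if y: "y \<in> Q" for y
    proof -
      have yG: "y \<in> carrier G" using y Q(1) subgroup.subset by blast
      have "coprime (card P) (card Q)"
        using P(2) Q(2) p(1) q False by (simp add: primes_coprime)
      then have "x \<otimes> y = y \<otimes> x"
        using coprime_commutingD[OF cc xG yG] subgroup_pow_card P(1) Q(1) x(1) y by blast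
      then have "commutator_of G x y = \<one>" using commutator_of_one_iff[OF xG yG] by simp
      then show ?thesis using yG subgroup.one_closed[OF sub] by (simp add: C_def)
    qed
    then show ?thesis using Q by blast
  qed
  have CG: "C \<subseteq> carrier G" using C by (rule subgroup.subset)
  then have "finite C" using fin finite_subset by blast
  then have C0: "card C \<noteq> 0" using subgroup.one_closed[OF C] by auto
  have "order G dvd card C"
  proof (rule multiplicity_le_imp_dvd[OF ord0])
    fix q :: nat assume q: "prime q"
    obtain Q where Q: "subgroup Q G" "card Q = q ^ multiplicity q (order G)" "Q \<subseteq> C"
      using Sylow_C[OF q] by blast
    then have "card Q dvd card C" using subgroup_card_dvd[OF Q(1) C] by simp
    then show "multiplicity q (order G) \<le> multiplicity q (card C)"
      using Q(2) q C0 by (intro multiplicity_geI) auto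
  qed
  then have "card (carrier G) \<le> card C" using C0 by (simp add: order_def dvd_imp_le)
  then have "C = carrier G" using CG fin by (simp add: card_seteq)
  then have "commutator_of G y x \<in> N" if "y \<in> carrier G" for y
    using that xG inv_commutator_of[of x y] subgroup.m_inv_closed[OF sub] by (force simp: C_def)
  then show ?thesis using x xG by (auto simp: center_mod_def)
qed

text \<open>
  The upper central series reaches \<open>G\<close>. To keep it out of the proof, the induction climbs through
  the normal subgroups \<open>N\<close> with the property that the lower central series reaches \<open>1\<close> as soon as
  one of its terms lies in \<open>N\<close>. The trivial subgroup has this property, it passes from \<open>N\<close> to
  \<open>center_mod N\<close>, and for \<open>N = G\<close> it is the claim.
\<close>

lemma coprime_commuting_imp_nilpotent:
  assumes fin: "finite (carrier G)" and cc: "coprime_commuting G"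
  shows "nilpotent_group G"
proof -
  have "\<exists>m. lower_central G m = {\<one>}"
    if "N \<lhd> G" "\<And>n. lower_central G n \<subseteq> N \<Longrightarrow> \<exists>m. lower_central G m = {\<one>}" for N
    using that
  proof (induction "card (carrier G - N)" arbitrary: N rule: less_induct)
    case less
    show ?case
    proof (cases "N = carrier G")
      case True
      then show ?thesis using less.prems(2)[of 0] by simp
    next
      case False
      let ?Z = "center_mod N"
      have Z: "?Z \<lhd> G" using less.prems(1) by (rule center_mod_normal)
      obtain x where x: "x \<in> ?Z" "x \<notin> N" using center_mod_grows[OF fin cc less.prems(1) False] by blast
      have "carrier G - ?Z \<subset> carrier G - N"
        using x subset_center_mod[OF less.prems(1)] by (auto simp: center_mod_def)
      then have smaller: "card (carrier G - ?Z) < card (carrier G - N)"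
        using fin by (intro psubset_card_mono) auto
      show ?thesis
      proof (rule less.hyps[OF smaller Z])
        fix n assume n: "lower_central G n \<subseteq> ?Z"
        have "commutator_of G z y \<in> N" if "z \<in> lower_central G n" "y \<in> carrier G" for z y
        proof -
          have "commutator_of G y z \<in> N" "z \<in> carrier G"
            using that n by (auto simp: center_mod_def)
          then show ?thesis
            using that inv_commutator_of[of y z] normal_invE(1)[OF less.prems(1)]
              subgroup.m_inv_closed by metis
        qed
        then have "lower_central G (Suc n) \<subseteq> N"
          unfolding lower_central_Suc
          by (intro generate_subgroup_incl normal_invE(1)[OF less.prems(1)]) auto
        then show "\<exists>m. lower_central G m = {\<one>}" by (rule less.prems(2))
      qed
    qed
  qed
  moreover have "\<exists>m. lower_central G m = {\<one>}" if "lower_central G n \<subseteq> {\<one>}" for n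
    using that normal_invE(1)[OF lower_central_normal[of n]] subgroup.one_closed by blast
  ultimately show ?thesis
    using one_is_normal is_group unfolding nilpotent_group_def by blast
qed

end

section \<open>Composition of term operations\<close>

lemma composed_mono:
  assumes "composed F n t" "F \<subseteq> F'"
  shows "composed F' n t"
  using assms(1)
proof (induction rule: composed.induct)
  case (composition k f gs)
  then have "\<forall>g \<in> set gs. composed F' n g" by blast
  then show ?case using composition assms(2) composed.composition[of k f F' gs n] by blast
qed (rule composed.projection)

lemma composed_subst:
  assumes "composed F n t" "length gs = n" "\<forall>g \<in> set gs. composed F k g"
  shows "composed F k (\<lambda>xs. t (map (\<lambda>g. g xs) gs))"
  using assms(1)
proof (induction rule: composed.induct)
  case (projection i)
  then have "(\<lambda>xs. map (\<lambda>g. g xs) gs ! i) = gs ! i" "gs ! i \<in> set gs" using assms(2) by auto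
  then show ?case using assms(3) by simp
next
  case (composition l f hs)
  have "composed F k (\<lambda>xs. f (map (\<lambda>h. h xs) (map (\<lambda>h xs. h (map (\<lambda>g. g xs) gs)) hs)))"
    by (rule composed.composition) (use composition in auto)
  then show ?case by (simp add: comp_def)
qed

lemma composed_binary:
  assumes "composed F 2 (\<lambda>xs. m (xs ! 0) (xs ! 1))" "composed F k s" "composed F k t"
  shows "composed F k (\<lambda>xs. m (s xs) (t xs))"
  using composed_subst[OF assms(1), of "[s, t]" k] assms(2,3) by simp

lemma composed_iterate:
  assumes m: "composed F 2 (\<lambda>xs. m (xs ! 0) (xs ! 1))" and s: "composed F k s" and t: "composed F k t"
  shows "composed F k (\<lambda>xs. ((\<lambda>z. m z (s xs)) ^^ j) (t xs))"
proof (induction j)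
  case (Suc j)
  then show ?case using composed_binary[OF m Suc s] by simp
qed (simp add: t)

section \<open>Absorbing operations of supernilpotent algebras\<close>

definition absorbing :: "'a set \<Rightarrow> 'a \<Rightarrow> nat \<Rightarrow> ('a list \<Rightarrow> 'a) \<Rightarrow> bool" where
  "absorbing U e n f \<longleftrightarrow> (\<forall>xs \<in> tuples U n. e \<in> set xs \<longrightarrow> f xs = e)"

lemma choose_blocks_singletons:
  assumes "length xs = Suc k"
  shows "choose_blocks (replicate (Suc k) [e]) (map (\<lambda>x. [x]) xs) k S =
    map (\<lambda>i. if i \<in> S then xs ! i else e) [0..<k]"
proof -
  have "map (\<lambda>i. if i \<in> S then map (\<lambda>x. [x]) xs ! i else replicate (Suc k) [e] ! i) [0..<k] =
      map (\<lambda>i. [if i \<in> S then xs ! i else e]) [0..<k]"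
    using assms by (intro map_cong) (auto simp del: replicate_Suc)
  then show ?thesis by (simp only: choose_blocks_def concat_map_singleton)
qed

text \<open>
  Apply the term condition with \<open>e\<close> for every \<open>a\<^sub>i\<close> and the \<open>i\<close>-th argument for \<open>b\<^sub>i\<close>. In each
  hypothesis some argument is \<open>e\<close> on both sides, so both values are \<open>e\<close>; in the conclusion the last
  argument on the left is \<open>e\<close>, and the right-hand side is the value of \<open>f\<close> in question.
\<close>

lemma supernilpotent_absorbing_trivial:
  assumes A: "closed_alg A" "supernilpotent A" and e: "e \<in> universe A"
  shows "\<exists>k \<ge> 1. \<forall>f xs. composed (basic_ops A) (Suc k) f \<longrightarrow> absorbing (universe A) e (Suc k) f \<longrightarrow>
    xs \<in> tuples (universe A) (Suc k) \<longrightarrow> f xs = e"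
proof -
  obtain k where k: "k \<ge> 1"
    "commutator A (replicate (Suc k) (one_congruence A)) = zero_congruence A"
    using A(2) by (auto simp: supernilpotent_def simp del: replicate_Suc)
  have TC: "term_condition A (replicate (Suc k) (one_congruence A)) (zero_congruence A)"
    using commutator_least(2)[OF A(1), of "replicate (Suc k) (one_congruence A)"] k(2)
      congruence_one[OF A(1)] by (simp del: replicate_Suc)
  have "f xs = e" if f: "composed (basic_ops A) (Suc k) f" and ab: "absorbing (universe A) e (Suc k) f"
    and xs: "xs \<in> tuples (universe A) (Suc k)" for f xs
  proof -
    let ?as = "replicate (Suc k) [e]" and ?bs = "map (\<lambda>x. [x]) xs"
    have len: "length xs = Suc k" "set xs \<subseteq> universe A" using xs by (auto simp: tuples_def)
    then have xsi: "xs ! i \<in> universe A" if "i < Suc k" for i using that by (metis nth_mem subsetD)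
    have lc: "length (concat ?as) = Suc k" by (simp add: length_concat sum_list_replicate)
    have poly: "is_polynomial_operation A (length (concat ?as)) f"
      unfolding is_polynomial_operation_def lc
      using composed_mono[OF f] by blast
    have vanish: "f (map (\<lambda>i. if i \<in> S then xs ! i else e) [0..<k] @ [z]) = e"
      if z: "z \<in> universe A" "z = e \<or> S \<subset> {0..<k}" for S z
    proof -
      let ?l = "map (\<lambda>i. if i \<in> S then xs ! i else e) [0..<k] @ [z]"
      have "e \<in> set ?l"
      proof (cases "z = e")
        case False
        then obtain i where "i \<in> {0..<k}" "i \<notin> S" using z(2) by blast
        then show ?thesis by (auto simp: image_iff intro!: bexI[of _ i])
      qed simp
      moreover have "?l \<in> tuples (universe A) (Suc k)"
        using z(1) xsi e by (auto simp: tuples_def)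
      ultimately show ?thesis using ab unfolding absorbing_def by blast
    qed
    have full: "map (\<lambda>i. if i \<in> {0..<k} then xs ! i else e) [0..<k] @ [xs ! k] = xs"
    proof (rule nth_equalityI)
      fix i assume "i < length (map (\<lambda>i. if i \<in> {0..<k} then xs ! i else e) [0..<k] @ [xs ! k])"
      then show "(map (\<lambda>i. if i \<in> {0..<k} then xs ! i else e) [0..<k] @ [xs ! k]) ! i = xs ! i"
        by (cases "i = k") (auto simp: nth_append)
    qed (use len in simp)
    have last: "?as ! k = [e]" "?bs ! k = [xs ! k]" using len by (auto simp del: replicate_Suc)
    have "(f (choose_blocks ?as ?bs k {0..<k} @ ?as ! k),
        f (choose_blocks ?as ?bs k {0..<k} @ ?bs ! k)) \<in> zero_congruence A"
    proof (rule TC[unfolded term_condition_def Let_def, rule_format, of ?as ?bs f, simplified length_replicate diff_Suc_1])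
      show "list_all2 (\<lambda>x y. (x, y) \<in> replicate (Suc k) (one_congruence A) ! i) (?as ! i) (?bs ! i)"
        if "i < Suc k" for i
        using that len e xsi by (simp add: one_congruence_def del: replicate_Suc)
      show "(f (choose_blocks ?as ?bs k S @ ?as ! k), f (choose_blocks ?as ?bs k S @ ?bs ! k))
          \<in> zero_congruence A" if "S \<subset> {0..<k}" for S
        unfolding choose_blocks_singletons[OF len(1)] last
        using vanish[OF e, of S] vanish[OF xsi[of k], of S] that e by (auto simp: zero_congruence_def)
    qed (use len poly in \<open>simp_all del: replicate_Suc\<close>)
    then have "f xs = f (map (\<lambda>i. if i \<in> {0..<k} then xs ! i else e) [0..<k] @ [e])"
      unfolding choose_blocks_singletons[OF len(1)] last full by (auto simp: zero_congruence_def)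
    also have "\<dots> = e" by (rule vanish) (use e in auto)
    finally show ?thesis .
  qed
  then show ?thesis using k(1) by blast
qed

section \<open>Powers in a group and in its reducts\<close>

text \<open>
  Powers of one element form a homomorphic image of the integers, on which every group term is
  an integer linear form.
\<close>

lemma composed_group_powers:
  fixes G (structure)
  assumes G: "group G" and t: "composed (basic_ops (group_algebra G)) n t"
  shows "\<exists>c :: nat \<Rightarrow> int. \<forall>x \<in> carrier G. \<forall>js. length js = n \<longrightarrow>
    t (map (\<lambda>j. x [^]\<^bsub>G\<^esub> j) js) = x [^]\<^bsub>G\<^esub> (\<Sum>i<n. c i * js ! i)"
  using t
proof (induction rule: composed.induct)
  case (projection i)
  have "(\<Sum>j<n. (if j = i then 1 else 0) * js ! j) = (js ! i :: int)" for js
    using projection by (simp add: if_distrib[of "\<lambda>c. c * _"] cong: if_cong)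
  then show ?case using projection by (intro exI[of _ "\<lambda>j. if j = i then 1 else 0"]) auto
next
  case (composition k f gs)
  interpret group G by (rule G)
  let ?P = "\<lambda>g c. \<forall>x \<in> carrier G. \<forall>js. length js = n \<longrightarrow>
    g (map (\<lambda>j. x [^] j) js) = x [^] (\<Sum>i<n. c i * js ! i :: int)"
  have IH: "\<exists>c. ?P g c" if "g \<in> set gs" for g using composition(3) that by blast
  consider (mult) "k = 2" "f = (\<lambda>xs. xs ! 0 \<otimes> xs ! 1)" | (inv) "k = 1" "f = (\<lambda>xs. inv (xs ! 0))"
    | (one) "k = 0" "f = (\<lambda>_. \<one>)"
    using composition(1) by (auto simp: group_algebra_def)
  then show ?case
  proof cases
    case mult
    then obtain g h where gs: "gs = [g, h]"
      using composition(2) by (auto simp: numeral_2_eq_2 length_Suc_conv)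
    obtain c d where cd: "?P g c" "?P h d" using IH[of g] IH[of h] gs by auto
    have "?P (\<lambda>xs. g xs \<otimes> h xs) (\<lambda>i. c i + d i)"
      using cd by (simp add: int_pow_mult distrib_right sum.distrib)
    then show ?thesis using mult gs by auto
  next
    case inv
    then obtain g where gs: "gs = [g]" using composition(2) by (auto simp: length_Suc_conv)
    obtain c where c: "?P g c" using IH[of g] gs by auto
    then show ?thesis
      unfolding inv gs by (intro exI[of _ "\<lambda>i. - c i"]) (simp add: int_pow_neg sum_negf)
  next
    case one
    show ?thesis unfolding one by (intro exI[of _ "\<lambda>_. 0"]) simp
  qed
qed

text \<open>
  On powers of \<open>x\<close> the term is \<open>(i, j) \<mapsto>\<close> \<open>x\<close> raised to \<open>c\<^sub>0 i + c\<^sub>1 j\<close>. At \<open>x = 1\<close> this gives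
  \<open>m 1 1 = 1 = m 1 e\<close>, so \<open>e = 1\<close> by cancellation. That \<open>e\<close> is an identity then says that raising to
  \<open>c\<^sub>0\<close> and to \<open>c\<^sub>1\<close> does nothing.
\<close>

lemma unital_term_preserves_powers:
  fixes G (structure)
  assumes G: "group G" and m: "is_term_operation (group_algebra G) 2 (\<lambda>xs. m (xs ! 0) (xs ! 1))"
    and e: "e \<in> carrier G" "\<And>x. x \<in> carrier G \<Longrightarrow> m x e = x" "\<And>x. x \<in> carrier G \<Longrightarrow> m e x = x"
    and cancel: "\<And>x y. x \<in> carrier G \<Longrightarrow> y \<in> carrier G \<Longrightarrow> m \<one>\<^bsub>G\<^esub> x = m \<one>\<^bsub>G\<^esub> y \<Longrightarrow> x = y"
  shows "e = \<one>\<^bsub>G\<^esub>"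
    and "\<And>x i j. x \<in> carrier G \<Longrightarrow>
      m (x [^]\<^bsub>G\<^esub> (i :: nat)) (x [^]\<^bsub>G\<^esub> (j :: nat)) = x [^]\<^bsub>G\<^esub> (i + j)"
proof -
  interpret group G by (rule G)
  obtain t where t: "composed (basic_ops (group_algebra G)) 2 t"
    and mt': "\<forall>xs \<in> tuples (carrier G) 2. m (xs ! 0) (xs ! 1) = t xs"
    using m unfolding is_term_operation_def by (auto simp: group_algebra_def)
  have mt: "m x y = t [x, y]" if "x \<in> carrier G" "y \<in> carrier G" for x y
    using bspec[OF mt', of "[x, y]"] that by (simp add: tuples_def)
  obtain c where c: "t (map (\<lambda>j. x [^] j) js) = x [^] (\<Sum>i<2. c i * js ! i :: int)"
    if "x \<in> carrier G" "length js = 2" for x js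
    using composed_group_powers[OF G t] by metis
  have m_pow: "m (x [^] (i :: int)) (x [^] (j :: int)) = (x [^] c 0) [^] i \<otimes> (x [^] c 1) [^] j"
    if "x \<in> carrier G" for x i j
  proof -
    have "t [x [^] i, x [^] j] = x [^] (c 0 * i + c 1 * j)"
      using c[OF that, of "[i, j]"] by (simp add: numeral_2_eq_2)
    then show ?thesis using that mt[of "x [^] i" "x [^] j"] by (simp add: int_pow_mult int_pow_pow)
  qed
  have "m \<one> \<one> = \<one>" using m_pow[of \<one> 0 0] by simp
  then show e1: "e = \<one>" using e by (metis cancel one_closed)
  have c0: "x [^] c 0 = x" and c1: "x [^] c 1 = x" if "x \<in> carrier G" for x
    using m_pow[OF that, of 1 0] m_pow[OF that, of 0 1] that e e1 by auto
  show "m (x [^] i) (x [^] j) = x [^] (i + j)" if "x \<in> carrier G" for x and i j :: nat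
    using m_pow[OF that, of "int i" "int j"] that
    unfolding c0[OF that] c1[OF that] by (simp add: int_pow_int nat_pow_mult)
qed

text \<open>
  Bezout coefficients provide an exponent that is \<open>0\<close> modulo \<open>a\<close> and \<open>1\<close> modulo \<open>b\<close>, and one with
  the roles exchanged; they exhibit \<open>y\<close> and \<open>x\<close> as powers of \<open>m x y\<close>.
\<close>

lemma (in group) commute_of_power_homomorphism:
  assumes m: "\<And>x y. x \<in> carrier G \<Longrightarrow> y \<in> carrier G \<Longrightarrow> m x y \<in> carrier G"
    "\<And>x. x \<in> carrier G \<Longrightarrow> m x \<one> = x" "\<And>x. x \<in> carrier G \<Longrightarrow> m \<one> x = x"
    and x: "x \<in> carrier G" "x [^] (a :: nat) = \<one>" and y: "y \<in> carrier G" "y [^] (b :: nat) = \<one>"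
    and ab: "coprime a b"
    and hom: "\<And>n :: nat. m x y [^] n = m (x [^] n) (y [^] n)"
  shows "x \<otimes> y = y \<otimes> x"
proof (cases "a = 0 \<or> b = 0")
  case True
  then have "x = \<one> \<or> y = \<one>" using ab x y by auto
  then show ?thesis using x y by auto
next
  case False
  let ?z = "m x y"
  have z: "?z \<in> carrier G" using m x y by simp
  have pow1: "u [^] (c * k) = \<one>" if "u \<in> carrier G" "u [^] c = \<one>" for u and c k :: nat
    using that by (metis nat_pow_one nat_pow_pow)
  obtain k l where "a * k = b * l + 1" using bezout_nat[of a b] False ab by auto
  then have "?z [^] (a * k) = m (x [^] (a * k)) (y [^] (b * l) \<otimes> y)"
    using hom[of "a * k"] by simp
  then have yz: "?z [^] (a * k) = y" using m x y pow1 by simp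
  obtain k' l' where "b * k' = a * l' + 1" using bezout_nat[of b a] False ab
    by (auto simp: coprime_commute)
  then have "?z [^] (b * k') = m (x [^] (a * l') \<otimes> x) (y [^] (b * k'))"
    using hom[of "b * k'"] by simp
  then have xz: "?z [^] (b * k') = x" using m x y pow1 by simp
  show ?thesis using nat_pow_comm[OF z, of "a * k" "b * k'"] unfolding yz xz ..
qed

section \<open>Coprime elements in supernilpotent loops\<close>

text \<open>
  The loop is presented by its multiplication \<open>m\<close> and right division \<open>d\<close> as term operations of an
  algebra \<open>A\<close>. This covers both signatures for loops: when the multiplication is the only basic
  operation of a finite loop, right division is an iterated multiplication.
\<close>

locale power_compatible_loop = group G for G (structure) +
  fixes A :: "'a alg" and m d :: "'a \<Rightarrow> 'a \<Rightarrow> 'a"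
  assumes universe: "universe A = carrier G" and closed: "closed_alg A"
    and m_term: "composed (basic_ops A) 2 (\<lambda>xs. m (xs ! 0) (xs ! 1))"
    and d_term: "composed (basic_ops A) 2 (\<lambda>xs. d (xs ! 0) (xs ! 1))"
    and m_one: "x \<in> carrier G \<Longrightarrow> m x \<one> = x" "x \<in> carrier G \<Longrightarrow> m \<one> x = x"
    and d_m: "x \<in> carrier G \<Longrightarrow> y \<in> carrier G \<Longrightarrow> d (m y x) x = y"
    and m_d: "x \<in> carrier G \<Longrightarrow> y \<in> carrier G \<Longrightarrow> m (d y x) x = y"
    and m_pow: "x \<in> carrier G \<Longrightarrow> m (x [^] (i :: nat)) (x [^] (j :: nat)) = x [^] (i + j)"
begin

lemma term_closed:
  assumes "composed (basic_ops A) n f" "length xs = n" "set xs \<subseteq> carrier G"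
  shows "f xs \<in> carrier G"
proof (rule composed_in_universe[OF assms(1)])
  show "xs \<in> tuples (carrier G) n" using assms(2,3) by (simp add: tuples_def)
  show "g ys \<in> carrier G" if "(k, g) \<in> basic_ops A" "ys \<in> tuples (carrier G) k" for k g ys
    using closed that unfolding closed_alg_def universe by blast
qed

lemma m_closed [simp]: "x \<in> carrier G \<Longrightarrow> y \<in> carrier G \<Longrightarrow> m x y \<in> carrier G"
  using term_closed[OF m_term, of "[x, y]"] by simp

lemma d_closed [simp]: "x \<in> carrier G \<Longrightarrow> y \<in> carrier G \<Longrightarrow> d x y \<in> carrier G"
  using term_closed[OF d_term, of "[x, y]"] by simp

lemma d_eq_one_iff: "x \<in> carrier G \<Longrightarrow> y \<in> carrier G \<Longrightarrow> d x y = \<one> \<longleftrightarrow> x = y"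
  by (metis d_m m_d m_one(2) one_closed)

text \<open>
  The parameter \<open>n\<close> counts the arguments besides the two coprime ones, so the arity of \<open>f\<close> is
  \<open>n + 2\<close>.
\<close>

definition coprime_vanishing :: "nat \<Rightarrow> bool" where
  "coprime_vanishing n \<longleftrightarrow> (\<forall>f x y zs. \<forall>a b :: nat.
    composed (basic_ops A) (Suc (Suc n)) f \<longrightarrow> absorbing (carrier G) \<one> (Suc (Suc n)) f \<longrightarrow>
    x \<in> carrier G \<longrightarrow> y \<in> carrier G \<longrightarrow> zs \<in> tuples (carrier G) n \<longrightarrow>
    coprime a b \<longrightarrow> x [^] a = \<one> \<longrightarrow> y [^] b = \<one> \<longrightarrow> f (x # y # zs) = \<one>)"

text \<open>
  The term \<open>D(u, v, w, ws) = f(u * w, v, ws) / (f(u, v, ws) * f(w, v, ws))\<close> is absorbing and has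
  one argument more than \<open>f\<close>. It therefore vanishes for \<open>u = x\<^sup>i\<close>, \<open>v = y\<close>, \<open>w = x\<^sup>j\<close>, which says
  that \<open>i \<mapsto> f(x\<^sup>i, y, zs)\<close> is additive. So \<open>f(x\<^sup>i, y, zs) = f(x, y, zs)\<^sup>i\<close>, and \<open>x\<^sup>a = 1\<close> yields the
  claim.
\<close>

lemma absorbing_first_power:
  assumes van: "coprime_vanishing (Suc n)"
    and f: "composed (basic_ops A) (Suc (Suc n)) f" "absorbing (carrier G) \<one> (Suc (Suc n)) f"
    and x: "x \<in> carrier G" "x [^] (a :: nat) = \<one>" and y: "y \<in> carrier G" "y [^] (b :: nat) = \<one>"
    and zs: "zs \<in> tuples (carrier G) n" and ab: "coprime a b"
  shows "f (x # y # zs) [^] a = \<one>"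
proof -
  define T where "T h = (\<lambda>ys. f (h ys # ys ! 1 # map (\<lambda>i. ys ! (i + 3)) [0..<n]))"
    for h :: "'a list \<Rightarrow> 'a"
  define D where "D = (\<lambda>ys. d (T (\<lambda>ys. m (ys ! 0) (ys ! 2)) ys)
    (m (T (\<lambda>ys. ys ! 0) ys) (T (\<lambda>ys. ys ! 2) ys)))"
  have T: "composed (basic_ops A) (n + 3) (T h)" if "composed (basic_ops A) (n + 3) h" for h
    using composed_subst[OF f(1), of "h # (\<lambda>ys. ys ! 1) # map (\<lambda>i ys. ys ! (i + 3)) [0..<n]" "n + 3"]
      that composed.projection[of _ "n + 3" "basic_ops A"]
    by (auto simp: T_def comp_def)
  have "composed (basic_ops A) (n + 3) D"
    unfolding D_def
    by (intro composed_binary[OF d_term] composed_binary[OF m_term] T composed.projection) auto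
  then have D: "composed (basic_ops A) (Suc (Suc (Suc n))) D" by (simp add: numeral_3_eq_3)
  have D_eq: "D (u # v # w # ws) = d (f (m u w # v # ws)) (m (f (u # v # ws)) (f (w # v # ws)))"
    if "length ws = n" for u v w ws
  proof -
    have "map (\<lambda>i. (u # v # w # ws) ! (i + 3)) [0..<n] = ws"
      using that map_nth[of ws] by (simp add: numeral_3_eq_3)
    then show ?thesis by (simp add: D_def T_def numeral_2_eq_2)
  qed
  have f_closed: "f (u # v # ws) \<in> carrier G"
    if "u \<in> carrier G" "v \<in> carrier G" "ws \<in> tuples (carrier G) n" for u v ws
    using term_closed[OF f(1)] that by (simp add: tuples_def)
  have f_one: "f (u # v # ws) = \<one>"
    if "u \<in> carrier G" "v \<in> carrier G" "ws \<in> tuples (carrier G) n" "u = \<one> \<or> v = \<one> \<or> \<one> \<in> set ws" for u v ws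
    using f(2) that unfolding absorbing_def by (auto simp: tuples_def)
  have "absorbing (carrier G) \<one> (Suc (Suc (Suc n))) D"
    unfolding absorbing_def
  proof (intro ballI impI)
    fix ys assume ys: "ys \<in> tuples (carrier G) (Suc (Suc (Suc n)))" "\<one> \<in> set ys"
    then obtain u v w ws where eq: "ys = u # v # w # ws"
      by (auto simp: tuples_def length_Suc_conv)
    have in_G: "u \<in> carrier G" "v \<in> carrier G" "w \<in> carrier G" and ws: "ws \<in> tuples (carrier G) n"
      using ys eq by (auto simp: tuples_def)
    then have "D ys = d (f (m u w # v # ws)) (m (f (u # v # ws)) (f (w # v # ws)))"
      using eq D_eq by (auto simp: tuples_def)
    moreover have "f (m u w # v # ws) = m (f (u # v # ws)) (f (w # v # ws))"
    proof -
      consider "u = \<one>" | "w = \<one>" | "v = \<one> \<or> \<one> \<in> set ws" using ys eq by auto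
      then show ?thesis
        by cases (use in_G ws in \<open>simp_all add: f_one f_closed m_one\<close>)
    qed
    ultimately show "D ys = \<one>" using in_G ws by (simp add: d_eq_one_iff f_closed)
  qed
  note D_vanish = van[unfolded coprime_vanishing_def, rule_format, OF D this]
  have pow_a: "(x [^] (i :: nat)) [^] a = \<one>" for i
    using x by (metis nat_pow_one nat_pow_pow mult.commute)
  have add: "f (x [^] (i + j) # y # zs) = m (f (x [^] i # y # zs)) (f (x [^] j # y # zs))" for i j :: nat
  proof -
    have "D (x [^] i # y # x [^] j # zs) = \<one>"
      by (rule D_vanish[OF _ _ _ ab pow_a y(2)]) (use x y zs in \<open>auto simp: tuples_def\<close>)
    moreover have "length zs = n" using zs by (simp add: tuples_def)
    ultimately show ?thesis
      using x y zs m_pow[OF x(1), of i j] by (simp add: D_eq d_eq_one_iff f_closed)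
  qed
  let ?c = "f (x # y # zs)"
  have "f (x [^] i # y # zs) = ?c [^] i" for i :: nat
  proof (induction i)
    case 0
    show ?case using f_one[of \<one> y zs] y zs by simp
  next
    case (Suc i)
    have "f (x [^] (i + 1) # y # zs) = m (?c [^] i) ?c"
      using add[of i 1] Suc x by simp
    also have "\<dots> = ?c [^] (i + 1)"
      using m_pow[of ?c i 1] f_closed[OF x(1) y(1) zs] by simp
    finally show ?case by simp
  qed
  from this[of a] show ?thesis using f_one[of \<one> y zs] x y zs by simp
qed

text \<open>
  Applied to \<open>f\<close>, and to \<open>f\<close> with its first two arguments exchanged, \<open>absorbing_first_power\<close>
  shows that the value is annihilated by two coprime numbers.
\<close>

lemma coprime_vanishing_descends:
  assumes van: "coprime_vanishing (Suc n)"
  shows "coprime_vanishing n"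
  unfolding coprime_vanishing_def
proof (intro allI impI)
  fix f x y zs and a b :: nat
  assume f: "composed (basic_ops A) (Suc (Suc n)) f" "absorbing (carrier G) \<one> (Suc (Suc n)) f"
    and x: "x \<in> carrier G" and y: "y \<in> carrier G" and zs: "zs \<in> tuples (carrier G) n"
    and ab: "coprime a b" and xa: "x [^] a = \<one>" and yb: "y [^] b = \<one>"
  define g where "g = (\<lambda>ys. f (ys ! 1 # ys ! 0 # map (\<lambda>i. ys ! (i + 2)) [0..<n]))"
  have "composed (basic_ops A) (n + 2) g"
    using composed_subst[OF f(1),
        of "(\<lambda>ys. ys ! 1) # (\<lambda>ys. ys ! 0) # map (\<lambda>i ys. ys ! (i + 2)) [0..<n]" "n + 2"]
      composed.projection[of _ "n + 2" "basic_ops A"]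
    by (auto simp: g_def comp_def)
  then have g: "composed (basic_ops A) (Suc (Suc n)) g" by simp
  have g_eq: "g (u # v # ws) = f (v # u # ws)" if "length ws = n" for u v ws
    using that map_nth[of ws] by (simp add: g_def numeral_2_eq_2)
  have "absorbing (carrier G) \<one> (Suc (Suc n)) g"
    using f(2) unfolding absorbing_def by (fastforce simp: tuples_def length_Suc_conv g_eq)
  then have "g (y # x # zs) [^] b = \<one>"
    using absorbing_first_power[OF van g] x y zs ab xa yb coprime_commute by blast
  then have "f (x # y # zs) [^] b = \<one>" using g_eq zs by (simp add: tuples_def)
  moreover have "f (x # y # zs) [^] a = \<one>"
    using absorbing_first_power[OF van f x xa y yb zs ab] .
  moreover have closed: "f (x # y # zs) \<in> carrier G"
    using term_closed[OF f(1)] x y zs by (simp add: tuples_def)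
  ultimately have "ord (f (x # y # zs)) dvd gcd a b" by (simp add: pow_eq_id)
  then have "f (x # y # zs) [^] (1 :: nat) = \<one>"
    using ab by (simp only: pow_eq_id[OF closed] coprime_iff_gcd_eq_1)
  then show "f (x # y # zs) = \<one>" using closed by simp
qed

lemma supernilpotent_imp_coprime_vanishing:
  assumes "supernilpotent A"
  shows "coprime_vanishing 0"
proof -
  obtain k where k: "k \<ge> 1" "\<And>f xs. composed (basic_ops A) (Suc k) f \<Longrightarrow>
      absorbing (carrier G) \<one> (Suc k) f \<Longrightarrow> xs \<in> tuples (carrier G) (Suc k) \<Longrightarrow> f xs = \<one>"
    using supernilpotent_absorbing_trivial[OF closed assms, of \<one>] unfolding universe by blast
  have "coprime_vanishing (k - 1)"
    unfolding coprime_vanishing_def using k by (auto simp: tuples_def)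
  moreover have "coprime_vanishing n \<Longrightarrow> coprime_vanishing 0" for n
    by (induction n) (auto intro: coprime_vanishing_descends)
  ultimately show ?thesis by blast
qed

lemma supernilpotent_imp_coprime_commuting:
  assumes "supernilpotent A"
  shows "coprime_commuting G"
  unfolding coprime_commuting_def
proof (intro ballI allI impI)
  fix x y and a b :: nat
  assume x: "x \<in> carrier G" "x [^] a = \<one>" and y: "y \<in> carrier G" "y [^] b = \<one>" and ab: "coprime a b"
  have hom: "m x y [^] n = m (x [^] n) (y [^] n)" for n :: nat
  proof (cases n)
    case 0
    then show ?thesis by (simp add: m_one)
  next
    case (Suc j)
    (* Applied to t, this is the term for the power with exponent n = j + 1. *)
    define P where "P t = (\<lambda>xs. ((\<lambda>z. m z (t xs)) ^^ j) (t xs))" for t :: "'a list \<Rightarrow> 'a"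
    have iter: "((\<lambda>z. m z u) ^^ i) u = u [^] Suc i" if "u \<in> carrier G" for u i
    proof (induction i)
      case (Suc i)
      then show ?case using m_pow[OF that, of "Suc i" 1] that by simp
    qed (use that in simp)
    define f where "f = (\<lambda>xs. d (P (\<lambda>xs. m (xs ! 0) (xs ! 1)) xs)
      (m (P (\<lambda>xs. xs ! 0) xs) (P (\<lambda>xs. xs ! 1) xs)))"
    have f: "composed (basic_ops A) (Suc (Suc 0)) f"
      unfolding f_def P_def
      by (intro composed_binary[OF d_term] composed_binary[OF m_term] composed_iterate[OF m_term]
          composed.projection) auto
    have f_eq: "f [u, v] = d (m u v [^] n) (m (u [^] n) (v [^] n))"
      if "u \<in> carrier G" "v \<in> carrier G" for u v
      using that by (simp add: f_def P_def iter Suc del: nat_pow_Suc)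
    have "absorbing (carrier G) \<one> (Suc (Suc 0)) f"
      unfolding absorbing_def
    proof (intro ballI impI)
      fix xs assume xs: "xs \<in> tuples (carrier G) (Suc (Suc 0))" "\<one> \<in> set xs"
      then obtain u v where "xs = [u, v]" by (auto simp: tuples_def length_Suc_conv)
      then show "f xs = \<one>"
        using xs by (auto simp: tuples_def f_eq m_one d_eq_one_iff)
    qed
    then have "f [x, y] = \<one>"
      using supernilpotent_imp_coprime_vanishing[OF assms] f x y ab
      unfolding coprime_vanishing_def by (auto simp: tuples_def)
    then show ?thesis using x y by (simp add: f_eq d_eq_one_iff)
  qed
  show "x \<otimes> y = y \<otimes> x"
    by (rule commute_of_power_homomorphism[of m x a y b]) (use x y ab hom m_one in auto)
qed

end

section \<open>Reducts that are loops or nilpotent groups\<close>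

text \<open>
  Under iteration of \<open>f x\<close> every \<open>y\<close> returns to itself after some time \<open>n x y\<close>; the product of these
  return times is a common period. It is written as a successor so that the inverse of \<open>f x\<close> is the \<open>N\<close>-th iterate.
\<close>

lemma common_iteration_period:
  assumes fin: "finite A" and f: "\<And>x. x \<in> A \<Longrightarrow> inj_on (f x) A" "\<And>x y. x \<in> A \<Longrightarrow> y \<in> A \<Longrightarrow> f x y \<in> A"
  shows "\<exists>N. \<forall>x \<in> A. \<forall>y \<in> A. (f x ^^ Suc N) y = y"
proof -
  have "\<exists>n > 0. (f x ^^ n) y = y" if x: "x \<in> A" and y: "y \<in> A" for x y
  proof -
    define p where "p z = (if z \<in> A then f x z else z)" for z
    have "inj p"
      using f[OF x] unfolding p_def inj_on_def by auto
    have p: "(p ^^ n) y = (f x ^^ n) y \<and> (p ^^ n) y \<in> A" for n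
      by (induction n) (use x y f in \<open>auto simp: p_def\<close>)
    then have "{z. \<exists>n. z = (p ^^ n) y} \<subseteq> A" by blast
    then have "finite {z. \<exists>n. z = (p ^^ n) y}" using fin by (rule finite_subset)
    from funpow_inj_finite[OF \<open>inj p\<close> this] show ?thesis using p by metis
  qed
  then obtain n where n: "n x y > 0" "(f x ^^ n x y) y = y" if "x \<in> A" "y \<in> A" for x y
    by metis
  let ?N = "\<Prod>(x, y) \<in> A \<times> A. n x y"
  have "?N > 0" using n by (auto intro!: prod_pos)
  moreover have "(f x ^^ ?N) y = y" if "x \<in> A" "y \<in> A" for x y
  proof -
    have "n x y dvd ?N" using that fin dvd_prodI[of "A \<times> A" "(x, y)" "\<lambda>(x, y). n x y"] by auto
    then obtain k where k: "?N = n x y * k" by blast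
    have "((f x ^^ n x y) ^^ k) y = y" by (induction k) (use n that in simp_all)
    then show ?thesis unfolding k by (simp add: funpow_mult mult.commute)
  qed
  ultimately show ?thesis by (metis Suc_pred)
qed

lemma loop_groupoid_right_division:
  assumes fin: "finite A" and loop: "is_loop_groupoid A m"
  obtains N where "\<And>x y. x \<in> A \<Longrightarrow> y \<in> A \<Longrightarrow> ((\<lambda>z. m z x) ^^ N) (m y x) = y"
    "\<And>x y. x \<in> A \<Longrightarrow> y \<in> A \<Longrightarrow> m (((\<lambda>z. m z x) ^^ N) y) x = y"
proof -
  have "\<exists>N. \<forall>x \<in> A. \<forall>y \<in> A. ((\<lambda>z. m z x) ^^ Suc N) y = y"
  proof (rule common_iteration_period[OF fin])
    fix x assume "x \<in> A"
    then show "inj_on (\<lambda>z. m z x) A"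
      using loop unfolding is_loop_groupoid_def inj_on_def by metis
  qed (use loop in \<open>simp add: is_loop_groupoid_def\<close>)
  then obtain N where N: "((\<lambda>z. m z x) ^^ Suc N) y = y" if "x \<in> A" "y \<in> A" for x y by blast
  show ?thesis
  proof
    show "((\<lambda>z. m z x) ^^ N) (m y x) = y" if "x \<in> A" "y \<in> A" for x y
      using N[OF that] by (simp add: funpow_Suc_right del: funpow.simps)
    show "m (((\<lambda>z. m z x) ^^ N) y) x = y" if "x \<in> A" "y \<in> A" for x y
      using N[OF that] by simp
  qed
qed

text \<open>
  Coprimality of two elements means the same in \<open>G\<close> and in \<open>H\<close>, because powers agree. Coprime
  elements commute in \<open>H\<close>, which gives the power identity there.
\<close>

lemma nilpotent_reduct_imp_coprime_commuting:
  fixes H :: "'a monoid"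
  assumes G: "group G" and H: "nilpotent_group H" "carrier H = carrier G"
    and m: "is_term_operation (group_algebra G) 2 (\<lambda>xs. xs ! 0 \<otimes>\<^bsub>H\<^esub> xs ! 1)"
  shows "coprime_commuting G"
proof -
  interpret G: group G by (rule G)
  interpret H: group H using H(1) by (simp add: nilpotent_group_def)
  have oneG: "\<one>\<^bsub>G\<^esub> \<in> carrier H" using H(2) by simp
  have one: "\<one>\<^bsub>H\<^esub> = \<one>\<^bsub>G\<^esub>"
    by (rule unital_term_preserves_powers(1)[OF G m]) (use oneG in \<open>auto simp flip: H(2)\<close>)
  have mp: "(x [^]\<^bsub>G\<^esub> (i :: nat)) \<otimes>\<^bsub>H\<^esub> (x [^]\<^bsub>G\<^esub> (j :: nat)) = x [^]\<^bsub>G\<^esub> (i + j)"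
    if "x \<in> carrier G" for x i j
    by (rule unital_term_preserves_powers(2)[OF G m _ _ _ _ that, of "\<one>\<^bsub>H\<^esub>"])
      (use oneG in \<open>auto simp flip: H(2)\<close>)
  have pow: "x [^]\<^bsub>H\<^esub> (n :: nat) = x [^]\<^bsub>G\<^esub> n" if "x \<in> carrier G" for x n
  proof (induction n)
    case (Suc n)
    then show ?case using mp[OF that, of n 1] that by simp
  qed (simp add: one)
  have cc: "coprime_commuting H" using H(1) by (rule H.nilpotent_imp_coprime_commuting)
  show ?thesis
    unfolding coprime_commuting_def
  proof (intro ballI allI impI)
    fix x y and a b :: nat
    assume x: "x \<in> carrier G" "x [^]\<^bsub>G\<^esub> a = \<one>\<^bsub>G\<^esub>" and y: "y \<in> carrier G" "y [^]\<^bsub>G\<^esub> b = \<one>\<^bsub>G\<^esub>"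
      and ab: "coprime a b"
    have "x \<otimes>\<^bsub>H\<^esub> y = y \<otimes>\<^bsub>H\<^esub> x"
      by (rule coprime_commutingD[OF cc _ _ ab]) (use x y H(2) in \<open>auto simp: pow one\<close>)
    then have hom: "(x \<otimes>\<^bsub>H\<^esub> y) [^]\<^bsub>G\<^esub> n = (x [^]\<^bsub>G\<^esub> n) \<otimes>\<^bsub>H\<^esub> (y [^]\<^bsub>G\<^esub> n)" for n :: nat
      using H.pow_mult_distrib[of x y n] x y H(2) H.m_closed[of x y] by (simp add: pow)
    show "x \<otimes>\<^bsub>G\<^esub> y = y \<otimes>\<^bsub>G\<^esub> x"
      by (rule G.commute_of_power_homomorphism[of "monoid.mult H" x a y b])
        (use x y ab hom H.r_one H.l_one H.m_closed in \<open>simp_all add: H(2) one\<close>)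
  qed
qed

lemma supernilpotent_loop_imp_coprime_commuting:
  fixes G (structure)
  assumes G: "group G" and loop: "is_loop (carrier G) m ld rd e"
    and red: "is_reduct (loop_algebra (carrier G) m ld rd e) (group_algebra G)"
    and sn: "supernilpotent (loop_algebra (carrier G) m ld rd e)"
  shows "coprime_commuting G"
proof -
  let ?A = "loop_algebra (carrier G) m ld rd e"
  have m: "is_term_operation (group_algebra G) 2 (\<lambda>xs. m (xs ! 0) (xs ! 1))"
    using red by (simp add: is_reduct_def loop_algebra_def)
  note l = loop[unfolded is_loop_def]
  have pp: "e = \<one>\<^bsub>G\<^esub>" "\<And>x i j. x \<in> carrier G \<Longrightarrow>
      m (x [^]\<^bsub>G\<^esub> (i :: nat)) (x [^]\<^bsub>G\<^esub> (j :: nat)) = x [^]\<^bsub>G\<^esub> (i + j)"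
    by (rule unital_term_preserves_powers[OF G m, of e];
      use l group.is_monoid[OF G] in \<open>metis monoid.one_closed\<close>)+
  interpret group G by (rule G)
  have basic: "composed (basic_ops ?A) 2 (\<lambda>xs. f (xs ! 0) (xs ! 1))" if "f = m \<or> f = rd" for f
    using composed.composition[of 2 "\<lambda>xs. f (xs ! 0) (xs ! 1)" "basic_ops ?A" "[\<lambda>xs. xs ! 0, \<lambda>xs. xs ! 1]" 2]
      composed.projection[of _ 2 "basic_ops ?A"] that
    by (auto simp: loop_algebra_def)
  have "power_compatible_loop G ?A m rd"
  proof unfold_locales
    show "closed_alg ?A"
      using l by (auto simp: closed_alg_def loop_algebra_def tuples_def numeral_2_eq_2 length_Suc_conv)
  qed (use l pp basic in \<open>auto simp: loop_algebra_def\<close>)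
  then show ?thesis using sn by (rule power_compatible_loop.supernilpotent_imp_coprime_commuting)
qed

lemma supernilpotent_groupoid_imp_coprime_commuting:
  fixes G (structure)
  assumes G: "group G" "finite (carrier G)"
    and m: "is_term_operation (group_algebra G) 2 (\<lambda>xs. m (xs ! 0) (xs ! 1))"
    and loop: "is_loop_groupoid (carrier G) m"
    and sn: "supernilpotent (groupoid_algebra (carrier G) m)"
  shows "coprime_commuting G"
proof -
  let ?A = "groupoid_algebra (carrier G) m"
  interpret group G by (rule G)
  obtain e where e: "e \<in> carrier G" "\<And>x. x \<in> carrier G \<Longrightarrow> m x e = x \<and> m e x = x"
    using loop by (auto simp: is_loop_groupoid_def)
  have cancel: "x = y" if "x \<in> carrier G" "y \<in> carrier G" "m \<one> x = m \<one> y" for x y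
    using loop that unfolding is_loop_groupoid_def by (metis one_closed)
  have pp: "e = \<one>" "\<And>x i j. x \<in> carrier G \<Longrightarrow> m (x [^] (i :: nat)) (x [^] (j :: nat)) = x [^] (i + j)"
    by (rule unital_term_preserves_powers[OF G(1) m, of e]; use e cancel in blast)+
  obtain N where N: "\<And>x y. x \<in> carrier G \<Longrightarrow> y \<in> carrier G \<Longrightarrow> ((\<lambda>z. m z x) ^^ N) (m y x) = y"
    "\<And>x y. x \<in> carrier G \<Longrightarrow> y \<in> carrier G \<Longrightarrow> m (((\<lambda>z. m z x) ^^ N) y) x = y"
    using loop_groupoid_right_division[OF G(2) loop] by blast
  have mA: "composed (basic_ops ?A) 2 (\<lambda>xs. m (xs ! 0) (xs ! 1))"
    using composed.composition[of 2 "\<lambda>xs. m (xs ! 0) (xs ! 1)" "basic_ops ?A" "[\<lambda>xs. xs ! 0, \<lambda>xs. xs ! 1]" 2]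
      composed.projection[of _ 2 "basic_ops ?A"]
    by (auto simp: groupoid_algebra_def)
  have "power_compatible_loop G ?A m (\<lambda>y x. ((\<lambda>z. m z x) ^^ N) y)"
  proof unfold_locales
    show "closed_alg ?A"
      using loop by (auto simp: closed_alg_def groupoid_algebra_def tuples_def numeral_2_eq_2
          length_Suc_conv is_loop_groupoid_def)
    show "composed (basic_ops ?A) 2 (\<lambda>xs. ((\<lambda>z. m z (xs ! 1)) ^^ N) (xs ! 0))"
      by (intro composed_iterate[OF mA] composed.projection) auto
  qed (use e pp N mA in \<open>auto simp: groupoid_algebra_def\<close>)
  then show ?thesis using sn by (rule power_compatible_loop.supernilpotent_imp_coprime_commuting)
qed

theorem lemma4p1:
  fixes G :: "('a, 'b) monoid_scheme"
  assumes "group G" and "finite (carrier G)" and "\<not> nilpotent_group G"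
  shows
    "(\<nexists>m ld rd e. is_loop (carrier G) m ld rd e \<and>
        is_reduct (loop_algebra (carrier G) m ld rd e) (group_algebra G) \<and>
        supernilpotent (loop_algebra (carrier G) m ld rd e)) \<and>
     (\<nexists>H :: 'a monoid. nilpotent_group H \<and>
        is_reduct (group_algebra H) (group_algebra G)) \<and>
     (\<nexists>m. is_term_operation (group_algebra G) 2 (\<lambda>xs. m (xs ! 0) (xs ! 1)) \<and>
        is_loop_groupoid (carrier G) m \<and>
        supernilpotent (groupoid_algebra (carrier G) m)) \<and>
     (\<nexists>m e. is_term_operation (group_algebra G) 2 (\<lambda>xs. m (xs ! 0) (xs ! 1)) \<and>
        nilpotent_group \<lparr>carrier = carrier G, mult = m, one = e\<rparr>)"
proof -
  have ncc: "\<not> coprime_commuting G"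
    using group.coprime_commuting_imp_nilpotent[OF assms(1,2)] assms(3) by blast
  have "\<not> is_reduct (group_algebra H) (group_algebra G)" if "nilpotent_group H" for H :: "'a monoid"
    using nilpotent_reduct_imp_coprime_commuting[OF assms(1) that] ncc
    by (auto simp: is_reduct_def group_algebra_def)
  moreover have "\<not> nilpotent_group \<lparr>carrier = carrier G, mult = m, one = e\<rparr>"
    if "is_term_operation (group_algebra G) 2 (\<lambda>xs. m (xs ! 0) (xs ! 1))" for m e
    using nilpotent_reduct_imp_coprime_commuting[OF assms(1),
        of "\<lparr>carrier = carrier G, mult = m, one = e\<rparr>"] that ncc by auto
  ultimately show ?thesis
    using supernilpotent_loop_imp_coprime_commuting[OF assms(1)]
      supernilpotent_groupoid_imp_coprime_commuting[OF assms(1,2)] ncc by blast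
qed

end
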